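(* The sequent calculus $\mathsf{G4WK}$ has the uniform interpolation property: there exist assignments giving, for each propositional variable $p$ and each finite multiset $\Gamma$ of formulas, a formula $E_p(\Gamma)$, and for each propositional variable $p$ and each $\mathsf{G4WK}$-sequent $\Gamma\Rightarrow\Delta$ (so $|\Delta|\le 1$), a formula $A_p(\Gamma\Rightarrow\Delta)$, such that for all $p$, $\Gamma$, $\Delta$ with $|\Delta|\le1$: (1) ($p$-freeness) the variables of $E_p(\Gamma)$ are among those of $\Gamma$ other than $p$, and the variables of $A_p(\Gamma\Rightarrow\Delta)$ are among those of $\Gamma\cup\Delta$ other than $p$; (2) (implication) $\vdash_{\mathsf{G4WK}}\Gamma\Rightarrow E_p(\Gamma)$ and $\vdash_{\mathsf{G4WK}}\Gamma, A_p(\Gamma\Rightarrow\Delta)\Rightarrow\Delta$; (3) (uniformity) for every finite multiset $\Pi$ of formulas in which $p$ does not occur, if $\vdash_{\mathsf{G4WK}}\Pi,\Gamma\Rightarrow\Delta$ then (a) $\vdash_{\mathsf{G4WK}}\Pi,E_p(\Gamma)\Rightarrow\Delta$ provided $p$ does not occur in $\Delta$, and (b) $\vdash_{\mathsf{G4WK}}\Pi,E_p(\Gamma)\Rightarrow A_p(\Gamma\Rightarrow\Delta)$.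
   Context: Formulas are built from a countably infinite set $\mathsf{Prop}$ of propositional variables by $\varphi ::= p \mid \bot \mid \varphi\wedge\varphi \mid \varphi\vee\varphi \mid \varphi\to\varphi \mid \Box\varphi \mid \Diamond\varphi$. For a multiset $\Gamma$ of formulas, $\Box^{-1}\Gamma=\{\varphi \mid \Box\varphi\in\Gamma\}$ and $\Diamond^{-1}\Gamma=\{\varphi\mid\Diamond\varphi\in\Gamma\}$ (with multiplicities). A sequent is $\Gamma\Rightarrow\Delta$ with $\Gamma,\Delta$ finite multisets of formulas; $\Gamma,\varphi$ means $\Gamma\uplus\{\varphi\}$, $\Gamma,\Pi$ means $\Gamma\uplus\Pi$, and a single formula on the right denotes a singleton. In $\mathsf{G4WK}$ succedents have at most one element. The rules of $\mathsf{G4WK}$ ($p\in\mathsf{Prop}$, $\Delta$ any succedent with $|\Delta|\le1$): ($\bot$L) $\Gamma,\bot\Rightarrow\Delta$ with no premises; (IdP) $\Gamma,p\Rightarrow p$ with no premises; ($\wedge$L) from $\Gamma,\varphi,\psi\Rightarrow\Delta$ infer $\Gamma,\varphi\wedge\psi\Rightarrow\Delta$; ($\wedge$R) from $\Gamma\Rightarrow\varphi$ and $\Gamma\Rightarrow\psi$ infer $\Gamma\Rightarrow\varphi\wedge\psi$; ($\vee$L) from $\Gamma,\varphi\Rightarrow\Delta$ and $\Gamma,\psi\Rightarrow\Delta$ infer $\Gamma,\varphi\vee\psi\Rightarrow\Delta$; ($\vee$R$_i$) from $\Gamma\Rightarrow\varphi_i$ infer $\Gamma\Rightarrow\varphi_1\vee\varphi_2$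 ($i=1,2$); ($\to$R) from $\Gamma,\varphi\Rightarrow\psi$ infer $\Gamma\Rightarrow\varphi\to\psi$; ($\wedge\!\to$L) from $\Gamma,\varphi\to(\psi\to\chi)\Rightarrow\Delta$ infer $\Gamma,(\varphi\wedge\psi)\to\chi\Rightarrow\Delta$; ($\vee\!\to$L) from $\Gamma,\varphi\to\chi,\psi\to\chi\Rightarrow\Delta$ infer $\Gamma,(\varphi\vee\psi)\to\chi\Rightarrow\Delta$; ($p\!\to$L) from $\Gamma,p,\varphi\Rightarrow\Delta$ infer $\Gamma,p,p\to\varphi\Rightarrow\Delta$; ($\to\to$L) from $\Gamma,\psi\to\chi\Rightarrow\varphi\to\psi$ and $\Gamma,\chi\Rightarrow\Delta$ infer $\Gamma,(\varphi\to\psi)\to\chi\Rightarrow\Delta$; ($\Box$R) from $\Box^{-1}\Gamma\Rightarrow\varphi$ infer $\Gamma\Rightarrow\Box\varphi$; ($\Box\!\to$L) from $\Box^{-1}\Gamma\Rightarrow\varphi$ and $\Gamma,\psi\Rightarrow\Delta$ infer $\Gamma,\Box\varphi\to\psi\Rightarrow\Delta$; ($\Diamond\!\to$L) from $\Box^{-1}\Gamma,\gamma\Rightarrow\varphi$ and $\Gamma,\Diamond\gamma,\psi\Rightarrow\Delta$ infer $\Gamma,\Diamond\gamma,\Diamond\varphi\to\psi\Rightarrow\Delta$; ($\Diamond$L$'$) from $\Box^{-1}\Gamma,\varphi\Rightarrow\Diamond^{-1}\Delta$ infer $\Gamma,\Diamond\varphi\Rightarrow\Delta$ (the premise succedent is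 $\{\delta\}$ if $\Delta=\{\Diamond\delta\}$ and empty otherwise). $\vdash_{\mathsf{G4WK}}\Gamma\Rightarrow\Delta$ means the sequent has a finite derivation in these rules. *)

theory Defs
  imports "HOL-Library.Multiset"
begin

type_synonym var = nat

datatype fm =
    Var var
  | Bot  ("\<^bold>\<bottom>")
  | And fm fm  (infixr "\<^bold>\<and>" 58)
  | Or fm fm  (infixr "\<^bold>\<or>" 57)
  | Imp fm fm  (infixr "\<^bold>\<rightarrow>" 56)
  | is_Box: Box (unBox: fm)  ("\<^bold>\<box> _" [60] 60)
  | is_Dia: Dia (unDia: fm)  ("\<^bold>\<diamond> _" [60] 60)

primrec vars :: "fm \<Rightarrow> var set" where
  "vars (Var q) = {q}"
| "vars \<^bold>\<bottom> = {}"
| "vars (\<phi> \<^bold>\<and> \<psi>) = vars \<phi> \<union> vars \<psi>"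
| "vars (\<phi> \<^bold>\<or> \<psi>) = vars \<phi> \<union> vars \<psi>"
| "vars (\<phi> \<^bold>\<rightarrow> \<psi>) = vars \<phi> \<union> vars \<psi>"
| "vars (\<^bold>\<box> \<phi>) = vars \<phi>"
| "vars (\<^bold>\<diamond> \<phi>) = vars \<phi>"

definition mvars :: "fm multiset \<Rightarrow> var set" where
  "mvars \<Gamma> = (\<Union>\<phi>\<in>set_mset \<Gamma>. vars \<phi>)"

definition box_inv :: "fm multiset \<Rightarrow> fm multiset" where
  "box_inv \<Gamma> = image_mset unBox (filter_mset is_Box \<Gamma>)"

definition dia_inv :: "fm multiset \<Rightarrow> fm multiset" where
  "dia_inv \<Gamma> = image_mset unDia (filter_mset is_Dia \<Gamma>)"

lemma count_box_inv: "count (box_inv \<Gamma>) \<phi> = count \<Gamma> (\<^bold>\<box> \<phi>)"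
proof (induction \<Gamma>)
  case (add \<psi> \<Gamma>)
  then show ?case by (cases \<psi>) (auto simp: box_inv_def)
qed (simp add: box_inv_def)

lemma count_dia_inv: "count (dia_inv \<Gamma>) \<phi> = count \<Gamma> (\<^bold>\<diamond> \<phi>)"
proof (induction \<Gamma>)
  case (add \<psi> \<Gamma>)
  then show ?case by (cases \<psi>) (auto simp: dia_inv_def)
qed (simp add: dia_inv_def)

text \<open>Derivability in G4WK. Succedents are multisets with at most one element; the bound is
  stated in every rule with an arbitrary succedent, so only such sequents are derivable.\<close>

inductive G4WK :: "fm multiset \<Rightarrow> fm multiset \<Rightarrow> bool"  (infix "\<turnstile>" 40) where
  BotL: "size \<Delta> \<le> 1 \<Longrightarrow> add_mset \<^bold>\<bottom> \<Gamma> \<turnstile> \<Delta>"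
| IdP: "add_mset (Var q) \<Gamma> \<turnstile> {#Var q#}"
| AndL: "size \<Delta> \<le> 1 \<Longrightarrow> add_mset \<phi> (add_mset \<psi> \<Gamma>) \<turnstile> \<Delta>
    \<Longrightarrow> add_mset (\<phi> \<^bold>\<and> \<psi>) \<Gamma> \<turnstile> \<Delta>"
| AndR: "\<Gamma> \<turnstile> {#\<phi>#} \<Longrightarrow> \<Gamma> \<turnstile> {#\<psi>#} \<Longrightarrow> \<Gamma> \<turnstile> {#\<phi> \<^bold>\<and> \<psi>#}"
| OrL: "size \<Delta> \<le> 1 \<Longrightarrow> add_mset \<phi> \<Gamma> \<turnstile> \<Delta> \<Longrightarrow> add_mset \<psi> \<Gamma> \<turnstile> \<Delta>
    \<Longrightarrow> add_mset (\<phi> \<^bold>\<or> \<psi>) \<Gamma> \<turnstile> \<Delta>"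
| OrR1: "\<Gamma> \<turnstile> {#\<phi>#} \<Longrightarrow> \<Gamma> \<turnstile> {#\<phi> \<^bold>\<or> \<psi>#}"
| OrR2: "\<Gamma> \<turnstile> {#\<psi>#} \<Longrightarrow> \<Gamma> \<turnstile> {#\<phi> \<^bold>\<or> \<psi>#}"
| ImpR: "add_mset \<phi> \<Gamma> \<turnstile> {#\<psi>#} \<Longrightarrow> \<Gamma> \<turnstile> {#\<phi> \<^bold>\<rightarrow> \<psi>#}"
| AndImpL: "size \<Delta> \<le> 1 \<Longrightarrow> add_mset (\<phi> \<^bold>\<rightarrow> (\<psi> \<^bold>\<rightarrow> \<chi>)) \<Gamma> \<turnstile> \<Delta>
    \<Longrightarrow> add_mset ((\<phi> \<^bold>\<and> \<psi>) \<^bold>\<rightarrow> \<chi>) \<Gamma> \<turnstile> \<Delta>"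
| OrImpL: "size \<Delta> \<le> 1 \<Longrightarrow> add_mset (\<phi> \<^bold>\<rightarrow> \<chi>) (add_mset (\<psi> \<^bold>\<rightarrow> \<chi>) \<Gamma>) \<turnstile> \<Delta>
    \<Longrightarrow> add_mset ((\<phi> \<^bold>\<or> \<psi>) \<^bold>\<rightarrow> \<chi>) \<Gamma> \<turnstile> \<Delta>"
| VarImpL: "size \<Delta> \<le> 1 \<Longrightarrow> add_mset (Var q) (add_mset \<phi> \<Gamma>) \<turnstile> \<Delta>
    \<Longrightarrow> add_mset (Var q) (add_mset (Var q \<^bold>\<rightarrow> \<phi>) \<Gamma>) \<turnstile> \<Delta>"
| ImpImpL: "size \<Delta> \<le> 1 \<Longrightarrow> add_mset (\<psi> \<^bold>\<rightarrow> \<chi>) \<Gamma> \<turnstile> {#\<phi> \<^bold>\<rightarrow> \<psi>#} \<Longrightarrow> add_mset \<chi> \<Gamma> \<turnstile> \<Delta>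
    \<Longrightarrow> add_mset ((\<phi> \<^bold>\<rightarrow> \<psi>) \<^bold>\<rightarrow> \<chi>) \<Gamma> \<turnstile> \<Delta>"
| BoxR: "box_inv \<Gamma> \<turnstile> {#\<phi>#} \<Longrightarrow> \<Gamma> \<turnstile> {#\<^bold>\<box> \<phi>#}"
| BoxImpL: "size \<Delta> \<le> 1 \<Longrightarrow> box_inv \<Gamma> \<turnstile> {#\<phi>#} \<Longrightarrow> add_mset \<psi> \<Gamma> \<turnstile> \<Delta>
    \<Longrightarrow> add_mset (\<^bold>\<box> \<phi> \<^bold>\<rightarrow> \<psi>) \<Gamma> \<turnstile> \<Delta>"
| DiaImpL: "size \<Delta> \<le> 1 \<Longrightarrow> add_mset \<gamma> (box_inv \<Gamma>) \<turnstile> {#\<phi>#}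
    \<Longrightarrow> add_mset (\<^bold>\<diamond> \<gamma>) (add_mset \<psi> \<Gamma>) \<turnstile> \<Delta>
    \<Longrightarrow> add_mset (\<^bold>\<diamond> \<gamma>) (add_mset (\<^bold>\<diamond> \<phi> \<^bold>\<rightarrow> \<psi>) \<Gamma>) \<turnstile> \<Delta>"
| DiaL: "size \<Delta> \<le> 1 \<Longrightarrow> add_mset \<phi> (box_inv \<Gamma>) \<turnstile> dia_inv \<Delta>
    \<Longrightarrow> add_mset (\<^bold>\<diamond> \<phi>) \<Gamma> \<turnstile> \<Delta>"

end

theory Submission
  imports Defs
begin

text \<open>Pitts' construction. A derivation of \<open>\<Pi>, \<Gamma> \<Rightarrow> \<Delta>\<close> is simulated by one that only sees \<open>\<Pi>\<close> and
  \<open>p\<close>-free formulas: every way in which a last rule can act on \<open>\<Gamma>\<close> or \<open>\<Delta>\<close> leads to premises of smaller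
  weight, whose interpolants are combined into a conjunct of \<open>E\<^sub>p(\<Gamma>)\<close> and a disjunct of
  \<open>A\<^sub>p(\<Gamma> \<Rightarrow> \<Delta>)\<close>. Taking \<open>A\<^sub>p(\<Gamma> \<Rightarrow> \<Delta>)\<close> to be the implication from \<open>E\<^sub>p(\<Gamma>)\<close> to this disjunction gives
  \<open>\<Pi> \<turnstile> A\<^sub>p(\<Gamma> \<Rightarrow> \<Delta>)\<close> whenever \<open>\<Pi>, \<Gamma> \<turnstile> \<Delta>\<close>. Neither cut nor contraction is needed, only weakening,
  the invertibility of left rules, and the ordinary left rule for implication, which is admissible.
  The interpolants exist by induction on weight, so they are chosen rather than computed.\<close>

text \<open>Two inductions are nested: an outer one on the weight of the sequent being interpolated,
  an inner one on the derivation of \<open>\<Pi> + \<Gamma> \<turnstile> \<Theta>\<close>. A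
  propositional rule acting on \<open>\<Pi>\<close> leaves \<Gamma> alone and is covered by the
  inner hypothesis; a rule acting on \<Gamma> lowers the weight. The obstacle is a modal rule acting
  on \<open>\<Pi>\<close>: it also replaces \<Gamma> by \<open>box_inv \<Gamma>\<close>, so the
  inner hypothesis, stated for \<Gamma>, does not fit its modal premise. The weight drops there
  unless nothing of \<Gamma> remains, and then there is nothing to interpolate. The weight of a
  multiset is the plain sum of the weights of its members, so natural numbers replace a multiset
  ordering. The step where cut would be tempting has \<open>\<Pi>\<close> deriving a guard \<alpha>,
  while the available conjunct is \<alpha> implying some \<open>E\<close>. The admissible left rule
  for implication joins the two directly.\<close>

section \<open>Modal inverses, variables and splitting of multisets\<close>

lemma box_inv_empty [simp]: "box_inv {#} = {#}"
  and box_inv_add [simp]: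
    "box_inv (add_mset \<phi> \<Gamma>) = (if is_Box \<phi> then add_mset (unBox \<phi>) (box_inv \<Gamma>) else box_inv \<Gamma>)"
  and box_inv_union [simp]: "box_inv (\<Gamma> + \<Delta>) = box_inv \<Gamma> + box_inv \<Delta>"
  by (simp_all add: box_inv_def)

lemma dia_inv_empty [simp]: "dia_inv {#} = {#}"
  and dia_inv_add [simp]:
    "dia_inv (add_mset \<phi> \<Gamma>) = (if is_Dia \<phi> then add_mset (unDia \<phi>) (dia_inv \<Gamma>) else dia_inv \<Gamma>)"
  and dia_inv_union [simp]: "dia_inv (\<Gamma> + \<Delta>) = dia_inv \<Gamma> + dia_inv \<Delta>"
  by (simp_all add: dia_inv_def)

lemma size_dia_inv: "size (dia_inv \<Gamma>) \<le> size \<Gamma>"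
  by (simp add: dia_inv_def size_filter_mset_lesseq)

lemma in_dia_inv_iff [simp]: "\<gamma> \<in># dia_inv \<Gamma> \<longleftrightarrow> \<^bold>\<diamond> \<gamma> \<in># \<Gamma>"
  by (simp add: count_dia_inv flip: count_greater_zero_iff)

lemma in_box_inv_iff [simp]: "\<gamma> \<in># box_inv \<Gamma> \<longleftrightarrow> \<^bold>\<box> \<gamma> \<in># \<Gamma>"
  by (simp add: count_box_inv flip: count_greater_zero_iff)

lemma mvars_empty [simp]: "mvars {#} = {}"
  and mvars_add [simp]: "mvars (add_mset \<phi> \<Gamma>) = vars \<phi> \<union> mvars \<Gamma>"
  and mvars_union [simp]: "mvars (\<Gamma> + \<Delta>) = mvars \<Gamma> \<union> mvars \<Delta>"
  by (auto simp: mvars_def)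

lemma mvars_box_inv: "mvars (box_inv \<Gamma>) \<subseteq> mvars \<Gamma>"
proof (induction \<Gamma>)
  case (add \<phi> \<Gamma>)
  then show ?case by (cases \<phi>) auto
qed simp

lemma mvars_dia_inv: "mvars (dia_inv \<Gamma>) \<subseteq> mvars \<Gamma>"
proof (induction \<Gamma>)
  case (add \<phi> \<Gamma>)
  then show ?case by (cases \<phi>) auto
qed simp

lemma add_mset_eq_unionE:
  assumes "add_mset x M = \<Pi> + \<Gamma>"
  obtains (left) \<Pi>' where "\<Pi> = add_mset x \<Pi>'" "M = \<Pi>' + \<Gamma>"
    | (right) \<Gamma>' where "\<Gamma> = add_mset x \<Gamma>'" "M = \<Pi> + \<Gamma>'"
proof -
  have "x \<in># \<Pi> + \<Gamma>"
    using assms by (metis union_single_eq_member)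
  then consider "x \<in># \<Pi>" | "x \<in># \<Gamma>"
    by auto
  then show thesis
  proof cases
    case 1
    with assms show ?thesis
      by (intro left[of "\<Pi> - {#x#}"]) (auto dest!: multi_member_split)
  next
    case 2
    with assms show ?thesis
      by (intro right[of "\<Gamma> - {#x#}"]) (auto dest!: multi_member_split)
  qed
qed

lemma add_mset_eq_add_msetE:
  assumes "add_mset x M = add_mset y N"
  obtains (same) "x = y" "M = N"
    | (diff) K where "M = add_mset y K" "N = add_mset x K"
  using assms by (auto simp: add_eq_conv_ex)

section \<open>Structural rules\<close>

lemma G4WK_size: "\<Gamma> \<turnstile> \<Delta> \<Longrightarrow> size \<Delta> \<le> 1"
  by (induction rule: G4WK.induct) auto

text \<open>\<Sigma> has to vary in the induction: the premise of a modal rule is weakened by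
  \<open>box_inv \<Sigma>\<close> instead of \<Sigma>.\<close>

lemma weakening: "\<Gamma> \<turnstile> \<Delta> \<Longrightarrow> \<Gamma> + \<Sigma> \<turnstile> \<Delta>"
  by (induction arbitrary: \<Sigma> rule: G4WK.induct) (auto intro: G4WK.intros)

lemma weakening1: "\<Gamma> \<turnstile> \<Delta> \<Longrightarrow> add_mset \<phi> \<Gamma> \<turnstile> \<Delta>"
  using weakening[of \<Gamma> \<Delta> "{#\<phi>#}"] by simp

lemma weakening_right: "\<Gamma> \<turnstile> {#} \<Longrightarrow> size \<Delta> \<le> 1 \<Longrightarrow> \<Gamma> \<turnstile> \<Delta>"
proof (induction \<Gamma> "{#} :: fm multiset" arbitrary: \<Delta> rule: G4WK.induct)
  case (DiaL \<phi> \<Gamma>)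
  then show ?case
    using size_dia_inv[of \<Delta>] by (auto intro!: G4WK.DiaL)
qed (auto intro: G4WK.intros)

text \<open>Lists the premises along which left rules can be inverted, \<open>M\<close> being what
  replaces the principal formula. For implications from a variable, an implication or a modal
  formula only the premise with the consequent \<chi> qualifies; the premise proving the antecedent
  cannot be recovered. A partner formula \<open>Var q\<close> or \<open>Dia \<gamma>\<close> need
  not be present.\<close>

inductive left_premise :: "fm \<Rightarrow> fm multiset \<Rightarrow> bool" where
  "left_premise (\<phi> \<^bold>\<and> \<psi>) {#\<phi>, \<psi>#}"
| "left_premise (\<phi> \<^bold>\<or> \<psi>) {#\<phi>#}"
| "left_premise (\<phi> \<^bold>\<or> \<psi>) {#\<psi>#}"
| "left_premise ((\<phi> \<^bold>\<and> \<psi>) \<^bold>\<rightarrow> \<chi>) {#\<phi> \<^bold>\<rightarrow> (\<psi> \<^bold>\<rightarrow> \<chi>)#}"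
| "left_premise ((\<phi> \<^bold>\<or> \<psi>) \<^bold>\<rightarrow> \<chi>) {#\<phi> \<^bold>\<rightarrow> \<chi>, \<psi> \<^bold>\<rightarrow> \<chi>#}"
| "left_premise (Var q \<^bold>\<rightarrow> \<chi>) {#\<chi>#}"
| "left_premise ((\<phi> \<^bold>\<rightarrow> \<psi>) \<^bold>\<rightarrow> \<chi>) {#\<chi>#}"
| "left_premise (\<^bold>\<box> \<phi> \<^bold>\<rightarrow> \<chi>) {#\<chi>#}"
| "left_premise (\<^bold>\<diamond> \<phi> \<^bold>\<rightarrow> \<chi>) {#\<chi>#}"

inductive_cases left_premiseE:
  "left_premise (Var q) M" "left_premise \<^bold>\<bottom> M" "left_premise (\<^bold>\<box> \<phi>) M" "left_premise (\<^bold>\<diamond> \<phi>) M"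
  "left_premise (\<phi> \<^bold>\<and> \<psi>) M" "left_premise (\<phi> \<^bold>\<or> \<psi>) M"
  "left_premise ((\<phi> \<^bold>\<and> \<psi>) \<^bold>\<rightarrow> \<chi>) M" "left_premise ((\<phi> \<^bold>\<or> \<psi>) \<^bold>\<rightarrow> \<chi>) M"
  "left_premise (Var q \<^bold>\<rightarrow> \<chi>) M" "left_premise ((\<phi> \<^bold>\<rightarrow> \<psi>) \<^bold>\<rightarrow> \<chi>) M"
  "left_premise (\<^bold>\<box> \<phi> \<^bold>\<rightarrow> \<chi>) M" "left_premise (\<^bold>\<diamond> \<phi> \<^bold>\<rightarrow> \<chi>) M"

lemma left_inversion:
  assumes "add_mset \<alpha> \<Gamma> \<turnstile> \<Delta>" "left_premise \<alpha> M"
  shows "M + \<Gamma> \<turnstile> \<Delta>"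
  using assms
proof (induction "add_mset \<alpha> \<Gamma>" \<Delta> arbitrary: \<Gamma> rule: G4WK.induct)
  case (BotL \<Delta> \<Gamma>')
  then show ?case
    by (auto simp: add_eq_conv_ex elim: left_premiseE intro!: G4WK.BotL)
next
  case (IdP q \<Gamma>')
  then show ?case
    by (auto simp: add_eq_conv_ex elim: left_premiseE intro!: G4WK.IdP)
next
  case (AndL \<Delta> \<phi> \<psi> \<Gamma>')
  from AndL(4) show ?case
  proof (cases rule: add_mset_eq_add_msetE)
    case same
    with AndL show ?thesis by (auto elim: left_premiseE)
  next
    case (diff K)
    with AndL.hyps(3)[of "add_mset \<phi> (add_mset \<psi> K)"] AndL show ?thesis
      by (auto simp: add_mset_commute intro!: G4WK.AndL)
  qed
next
  case (AndR \<phi> \<psi>)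
  then show ?case
    by (auto intro!: G4WK.AndR)
next
  case (OrL \<Delta> \<phi> \<Gamma>' \<psi>)
  from OrL(6) show ?case
  proof (cases rule: add_mset_eq_add_msetE)
    case same
    with OrL show ?thesis by (auto elim: left_premiseE)
  next
    case (diff K)
    with OrL.hyps(3)[of "add_mset \<phi> K"] OrL.hyps(5)[of "add_mset \<psi> K"] OrL show ?thesis
      by (auto simp: add_mset_commute intro!: G4WK.OrL)
  qed
next
  case (OrR1 \<phi> \<psi>)
  then show ?case
    by (auto intro!: G4WK.OrR1)
next
  case (OrR2 \<phi> \<psi>)
  then show ?case
    by (auto intro!: G4WK.OrR2)
next
  case (ImpR \<phi> \<psi>)
  from ImpR(2)[of "add_mset \<phi> \<Gamma>"] ImpR(3) show ?case
    by (auto simp: add_mset_commute intro!: G4WK.ImpR)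
next
  case (AndImpL \<Delta> \<phi> \<psi> \<chi> \<Gamma>')
  from AndImpL(4) show ?case
  proof (cases rule: add_mset_eq_add_msetE)
    case same
    with AndImpL show ?thesis by (auto elim: left_premiseE)
  next
    case (diff K)
    with AndImpL.hyps(3)[of "add_mset (\<phi> \<^bold>\<rightarrow> (\<psi> \<^bold>\<rightarrow> \<chi>)) K"] AndImpL show ?thesis
      by (auto simp: add_mset_commute intro!: G4WK.AndImpL)
  qed
next
  case (OrImpL \<Delta> \<phi> \<chi> \<psi> \<Gamma>')
  from OrImpL(4) show ?case
  proof (cases rule: add_mset_eq_add_msetE)
    case same
    with OrImpL show ?thesis by (auto elim: left_premiseE)
  next
    case (diff K)
    with OrImpL.hyps(3)[of "add_mset (\<phi> \<^bold>\<rightarrow> \<chi>) (add_mset (\<psi> \<^bold>\<rightarrow> \<chi>) K)"] OrImpL show ?thesis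
      by (auto simp: add_mset_commute intro!: G4WK.OrImpL)
  qed
next
  case (VarImpL \<Delta> q \<phi> \<Gamma>')
  from VarImpL(4) show ?case
  proof (cases rule: add_mset_eq_add_msetE)
    case same
    with VarImpL show ?thesis by (auto elim: left_premiseE)
  next
    case (diff K)
    from diff(1) show ?thesis
    proof (cases rule: add_mset_eq_add_msetE)
      case same
      with VarImpL diff show ?thesis by (auto elim: left_premiseE)
    next
      case (diff K')
      with VarImpL.hyps(3)[of "add_mset (Var q) (add_mset \<phi> K')"] VarImpL \<open>\<Gamma> = _\<close> show ?thesis
        by (auto simp: add_mset_commute intro!: G4WK.VarImpL)
    qed
  qed
next
  case (ImpImpL \<Delta> \<psi> \<chi> \<Gamma>' \<phi>)
  from ImpImpL(6) show ?case
  proof (cases rule: add_mset_eq_add_msetE)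
    case same
    with ImpImpL show ?thesis by (auto elim: left_premiseE)
  next
    case (diff K)
    with ImpImpL.hyps(3)[of "add_mset (\<psi> \<^bold>\<rightarrow> \<chi>) K"] ImpImpL.hyps(5)[of "add_mset \<chi> K"] ImpImpL
    show ?thesis
      by (auto simp: add_mset_commute intro!: G4WK.ImpImpL)
  qed
next
  case (BoxR \<phi>)
  \<comment> \<open>\<alpha> is not a box, so it leaves no trace in the modal premise.
    \<open>M\<close> may contain boxes, and weakening supplies what they contribute. The other modal
    rules are treated in the same way.\<close>
  then have "box_inv \<Gamma> \<turnstile> {#\<phi>#}"
    by (cases \<alpha>) (auto elim: left_premiseE)
  then show ?case
    using weakening[of "box_inv \<Gamma>" _ "box_inv M"] by (auto simp: add.commute intro!: G4WK.BoxR)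
next
  case (BoxImpL \<Delta> \<Gamma>' \<phi> \<psi>)
  from BoxImpL(6) show ?case
  proof (cases rule: add_mset_eq_add_msetE)
    case same
    with BoxImpL show ?thesis by (auto elim: left_premiseE)
  next
    case (diff K)
    with BoxImpL have "box_inv K \<turnstile> {#\<phi>#}"
      by (cases \<alpha>) (auto elim: left_premiseE)
    with weakening[of "box_inv K" _ "box_inv M"] diff BoxImpL.hyps(5)[of "add_mset \<psi> K"] BoxImpL
    show ?thesis
      by (auto simp: add_mset_commute add.commute intro!: G4WK.BoxImpL)
  qed
next
  case (DiaImpL \<Delta> \<gamma> \<Gamma>' \<phi> \<psi>)
  from DiaImpL(6) show ?case
  proof (cases rule: add_mset_eq_add_msetE)
    case same
    with DiaImpL show ?thesis by (auto elim: left_premiseE)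
  next
    case (diff K)
    from diff(1) show ?thesis
    proof (cases rule: add_mset_eq_add_msetE)
      case same
      with DiaImpL diff show ?thesis by (auto elim: left_premiseE)
    next
      case (diff K')
      with DiaImpL have "add_mset \<gamma> (box_inv K') \<turnstile> {#\<phi>#}"
        by (cases \<alpha>) (auto elim: left_premiseE)
      with weakening[of "add_mset \<gamma> (box_inv K')" _ "box_inv M"] diff
        DiaImpL.hyps(5)[of "add_mset (\<^bold>\<diamond> \<gamma>) (add_mset \<psi> K')"] DiaImpL \<open>\<Gamma> = _\<close>
      show ?thesis
        by (auto simp: add_mset_commute add.commute intro!: G4WK.DiaImpL)
    qed
  qed
next
  case (DiaL \<Delta> \<phi> \<Gamma>')
  from DiaL(4) show ?case
  proof (cases rule: add_mset_eq_add_msetE)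
    case same
    with DiaL show ?thesis by (auto elim: left_premiseE)
  next
    case (diff K)
    with DiaL have "add_mset \<phi> (box_inv K) \<turnstile> dia_inv \<Delta>"
      by (cases \<alpha>) (auto elim: left_premiseE)
    with weakening[of "add_mset \<phi> (box_inv K)" _ "box_inv M"] diff DiaL show ?thesis
      by (auto simp: add.commute intro!: G4WK.DiaL)
  qed
qed

text \<open>Induction on the derivation of the first premise. If it ends in a right rule, the shape
  of \<phi> selects the special left rule for the implication. If it ends in a left rule, the second
  premise is inverted along the same rule, and that rule is applied last.\<close>

lemma ImpL: "\<Gamma> \<turnstile> {#\<phi>#} \<Longrightarrow> add_mset \<psi> \<Gamma> \<turnstile> \<Delta> \<Longrightarrow> add_mset (\<phi> \<^bold>\<rightarrow> \<psi>) \<Gamma> \<turnstile> \<Delta>"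
proof (induction \<Gamma> "{#\<phi>#}" arbitrary: \<phi> \<psi> \<Delta> rule: G4WK.induct)
  case (BotL \<Gamma>)
  then show ?case
    using G4WK.BotL[OF G4WK_size] by (simp add: add_mset_commute)
next
  case (IdP q \<Gamma>)
  then show ?case
    by (auto simp: add_mset_commute intro!: G4WK.VarImpL intro: G4WK_size)
next
  case (AndL \<alpha> \<beta> \<Gamma>)
  from left_inversion[of "\<alpha> \<^bold>\<and> \<beta>" "add_mset \<psi> \<Gamma>" \<Delta> "{#\<alpha>, \<beta>#}"] AndL.prems
  have "add_mset \<psi> (add_mset \<alpha> (add_mset \<beta> \<Gamma>)) \<turnstile> \<Delta>"
    by (simp add: add_mset_commute left_premise.intros)
  from AndL.hyps(3)[OF refl this] show ?case
    using G4WK.AndL[OF G4WK_size, of _ \<Delta> \<alpha> \<beta> "add_mset (\<phi> \<^bold>\<rightarrow> \<psi>) \<Gamma>"]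
    by (simp add: add_mset_commute)
next
  case (AndR \<Gamma> \<alpha> \<beta>)
  then have "add_mset (\<alpha> \<^bold>\<rightarrow> (\<beta> \<^bold>\<rightarrow> \<psi>)) \<Gamma> \<turnstile> \<Delta>"
    by blast
  with AndR.hyps(5) show ?case
    using G4WK.AndImpL G4WK_size by blast
next
  case (OrL \<alpha> \<Gamma> \<beta>)
  from left_inversion[of "\<alpha> \<^bold>\<or> \<beta>" "add_mset \<psi> \<Gamma>" \<Delta> "{#\<alpha>#}"]
    left_inversion[of "\<alpha> \<^bold>\<or> \<beta>" "add_mset \<psi> \<Gamma>" \<Delta> "{#\<beta>#}"] OrL.prems
  have "add_mset \<psi> (add_mset \<alpha> \<Gamma>) \<turnstile> \<Delta>" "add_mset \<psi> (add_mset \<beta> \<Gamma>) \<turnstile> \<Delta>"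
    by (simp_all add: add_mset_commute left_premise.intros)
  from OrL.hyps(3)[OF refl this(1)] OrL.hyps(5)[OF refl this(2)] show ?case
    using G4WK.OrL[OF G4WK_size, of _ \<Delta> \<alpha> "add_mset (\<phi> \<^bold>\<rightarrow> \<psi>) \<Gamma>" \<beta>]
    by (simp add: add_mset_commute)
next
  case (OrR1 \<Gamma> \<alpha> \<beta>)
  then have "add_mset (\<alpha> \<^bold>\<rightarrow> \<psi>) (add_mset (\<beta> \<^bold>\<rightarrow> \<psi>) \<Gamma>) \<turnstile> \<Delta>"
    using weakening1 by (metis add_mset_commute)
  with OrR1.hyps(3) show ?case
    using G4WK.OrImpL G4WK_size by blast
next
  case (OrR2 \<Gamma> \<beta> \<alpha>)
  then have "add_mset (\<alpha> \<^bold>\<rightarrow> \<psi>) (add_mset (\<beta> \<^bold>\<rightarrow> \<psi>) \<Gamma>) \<turnstile> \<Delta>"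
    using weakening1 by blast
  with OrR2.hyps(3) show ?case
    using G4WK.OrImpL G4WK_size by blast
next
  case (ImpR \<alpha> \<Gamma> \<beta>)
  have "add_mset (\<beta> \<^bold>\<rightarrow> \<psi>) \<Gamma> \<turnstile> {#\<alpha> \<^bold>\<rightarrow> \<beta>#}"
    using weakening1[OF G4WK.ImpR[OF ImpR.hyps(1)]] .
  with ImpR.hyps(3) ImpR.prems show ?case
    using G4WK.ImpImpL G4WK_size by blast
next
  case (AndImpL \<alpha> \<beta> \<chi> \<Gamma>)
  from left_inversion[of "(\<alpha> \<^bold>\<and> \<beta>) \<^bold>\<rightarrow> \<chi>" "add_mset \<psi> \<Gamma>" \<Delta> "{#\<alpha> \<^bold>\<rightarrow> (\<beta> \<^bold>\<rightarrow> \<chi>)#}"] AndImpL.prems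
  have "add_mset \<psi> (add_mset (\<alpha> \<^bold>\<rightarrow> (\<beta> \<^bold>\<rightarrow> \<chi>)) \<Gamma>) \<turnstile> \<Delta>"
    by (simp add: add_mset_commute left_premise.intros)
  from AndImpL.hyps(3)[OF refl this] show ?case
    using G4WK.AndImpL[OF G4WK_size, of _ \<Delta> \<alpha> \<beta> \<chi> "add_mset (\<phi> \<^bold>\<rightarrow> \<psi>) \<Gamma>"]
    by (simp add: add_mset_commute)
next
  case (OrImpL \<alpha> \<chi> \<beta> \<Gamma>)
  from left_inversion[of "(\<alpha> \<^bold>\<or> \<beta>) \<^bold>\<rightarrow> \<chi>" "add_mset \<psi> \<Gamma>" \<Delta> "{#\<alpha> \<^bold>\<rightarrow> \<chi>, \<beta> \<^bold>\<rightarrow> \<chi>#}"] OrImpL.prems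
  have "add_mset \<psi> (add_mset (\<alpha> \<^bold>\<rightarrow> \<chi>) (add_mset (\<beta> \<^bold>\<rightarrow> \<chi>) \<Gamma>)) \<turnstile> \<Delta>"
    by (simp add: add_mset_commute left_premise.intros)
  from OrImpL.hyps(3)[OF refl this] show ?case
    using G4WK.OrImpL[OF G4WK_size, of _ \<Delta> \<alpha> \<chi> \<beta> "add_mset (\<phi> \<^bold>\<rightarrow> \<psi>) \<Gamma>"]
    by (simp add: add_mset_commute)
next
  case (VarImpL q \<chi> \<Gamma>)
  from left_inversion[of "Var q \<^bold>\<rightarrow> \<chi>" "add_mset \<psi> (add_mset (Var q) \<Gamma>)" \<Delta> "{#\<chi>#}"] VarImpL.prems
  have "add_mset \<psi> (add_mset (Var q) (add_mset \<chi> \<Gamma>)) \<turnstile> \<Delta>"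
    by (simp add: add_mset_commute left_premise.intros)
  from VarImpL.hyps(3)[OF refl this] show ?case
    using G4WK.VarImpL[OF G4WK_size, of _ \<Delta> q \<chi> "add_mset (\<phi> \<^bold>\<rightarrow> \<psi>) \<Gamma>"]
    by (simp add: add_mset_commute)
next
  case (ImpImpL \<beta> \<chi> \<Gamma> \<alpha>)
  from left_inversion[of "(\<alpha> \<^bold>\<rightarrow> \<beta>) \<^bold>\<rightarrow> \<chi>" "add_mset \<psi> \<Gamma>" \<Delta> "{#\<chi>#}"] ImpImpL.prems
  have "add_mset \<psi> (add_mset \<chi> \<Gamma>) \<turnstile> \<Delta>"
    by (simp add: add_mset_commute left_premise.intros)
  from ImpImpL.hyps(5)[OF refl this] weakening1[OF ImpImpL.hyps(2), of "\<phi> \<^bold>\<rightarrow> \<psi>"] show ?case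
    using G4WK.ImpImpL[OF G4WK_size, of _ \<Delta> \<beta> \<chi> "add_mset (\<phi> \<^bold>\<rightarrow> \<psi>) \<Gamma>" \<alpha>]
    by (simp add: add_mset_commute)
next
  case (BoxR \<Gamma> \<alpha>)
  then show ?case
    using G4WK.BoxImpL G4WK_size by blast
next
  case (BoxImpL \<Gamma> \<alpha> \<chi>)
  from left_inversion[of "\<^bold>\<box> \<alpha> \<^bold>\<rightarrow> \<chi>" "add_mset \<psi> \<Gamma>" \<Delta> "{#\<chi>#}"] BoxImpL.prems
  have "add_mset \<psi> (add_mset \<chi> \<Gamma>) \<turnstile> \<Delta>"
    by (simp add: add_mset_commute left_premise.intros)
  from BoxImpL.hyps(5)[OF refl this] BoxImpL.hyps(2) show ?case
    using G4WK.BoxImpL[OF G4WK_size, of _ \<Delta> "add_mset (\<phi> \<^bold>\<rightarrow> \<psi>) \<Gamma>" \<alpha> \<chi>]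
    by (simp add: add_mset_commute)
next
  case (DiaImpL \<gamma> \<Gamma> \<alpha> \<chi>)
  from left_inversion[of "\<^bold>\<diamond> \<alpha> \<^bold>\<rightarrow> \<chi>" "add_mset \<psi> (add_mset (\<^bold>\<diamond> \<gamma>) \<Gamma>)" \<Delta> "{#\<chi>#}"] DiaImpL.prems
  have "add_mset \<psi> (add_mset (\<^bold>\<diamond> \<gamma>) (add_mset \<chi> \<Gamma>)) \<turnstile> \<Delta>"
    by (simp add: add_mset_commute left_premise.intros)
  from DiaImpL.hyps(5)[OF refl this] DiaImpL.hyps(2) show ?case
    using G4WK.DiaImpL[OF G4WK_size, of _ \<Delta> \<gamma> "add_mset (\<phi> \<^bold>\<rightarrow> \<psi>) \<Gamma>" \<alpha> \<chi>]
    by (simp add: add_mset_commute)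
next
  case (DiaL \<gamma> \<Gamma>)
  show ?case
  \<comment> \<open>If \<phi> is a diamond, the given premise is exactly the first premise of
    \<open>DiaImpL\<close>. Otherwise \<open>dia_inv {#\<phi>#}\<close> is empty, so the premise
    refutes its antecedent and \<open>DiaL\<close> reaches any succedent.\<close>
  proof (cases "is_Dia \<phi>")
    case True
    with DiaL show ?thesis
      using G4WK.DiaImpL[OF G4WK_size, of _ \<Delta> \<gamma> \<Gamma> "unDia \<phi>" \<psi>]
      by (auto simp: add_mset_commute)
  next
    case False
    with DiaL have "add_mset \<gamma> (box_inv \<Gamma>) \<turnstile> {#}"
      by simp
    moreover have "size \<Delta> \<le> 1"
      using DiaL.prems by (rule G4WK_size)
    ultimately show ?thesis
      using G4WK.DiaL[of \<Delta> \<gamma> "add_mset (\<phi> \<^bold>\<rightarrow> \<psi>) \<Gamma>"] size_dia_inv[of \<Delta>]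
      by (simp add: add_mset_commute weakening_right)
  qed
qed

section \<open>Finite conjunctions and disjunctions\<close>

abbreviation Top :: fm where
  "Top \<equiv> \<^bold>\<bottom> \<^bold>\<rightarrow> \<^bold>\<bottom>"

lemma Top_derivable: "\<Gamma> \<turnstile> {#Top#}"
  by (intro G4WK.ImpR G4WK.BotL) simp

text \<open>Any enumeration will do: big conjunctions and disjunctions are used only through their
  variables and their left and right rules, which do not see the order.\<close>

definition list_of_mset :: "'a multiset \<Rightarrow> 'a list" where
  "list_of_mset M = (SOME xs. mset xs = M)"

lemma mset_list_of_mset [simp]: "mset (list_of_mset M) = M"
  unfolding list_of_mset_def by (rule someI_ex) (rule ex_mset)

definition BigAnd :: "fm multiset \<Rightarrow> fm" where
  "BigAnd M = foldr And (list_of_mset M) Top"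

definition BigOr :: "fm multiset \<Rightarrow> fm" where
  "BigOr M = foldr Or (list_of_mset M) \<^bold>\<bottom>"

lemma vars_BigAnd: "vars (BigAnd M) = mvars M"
proof -
  have "vars (foldr And xs Top) = mvars (mset xs)" for xs
    by (induction xs) auto
  then show ?thesis
    by (simp add: BigAnd_def)
qed

lemma vars_BigOr: "vars (BigOr M) = mvars M"
proof -
  have "vars (foldr Or xs \<^bold>\<bottom>) = mvars (mset xs)" for xs
    by (induction xs) auto
  then show ?thesis
    by (simp add: BigOr_def)
qed

text \<open>All conjuncts are released at once, each exactly once. This is the bridge from a
  derivation over the multiset \<open>E_context p \<Gamma>\<close> to one over a single
  formula.\<close>

lemma BigAndL:
  assumes "\<Gamma> + M \<turnstile> \<Delta>"
  shows "add_mset (BigAnd M) \<Gamma> \<turnstile> \<Delta>"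
proof -
  have "\<Gamma> + mset xs \<turnstile> \<Delta> \<Longrightarrow> add_mset (foldr And xs Top) \<Gamma> \<turnstile> \<Delta>" for xs \<Gamma>
  proof (induction xs arbitrary: \<Gamma>)
    case Nil
    then show ?case by (simp add: weakening1)
  next
    case (Cons x xs)
    from Cons.IH[of "add_mset x \<Gamma>"] Cons.prems G4WK_size[OF Cons.prems] show ?case
      by (auto simp: add_mset_commute intro!: G4WK.AndL)
  qed
  from this[of \<Gamma> "list_of_mset M"] assms show ?thesis
    by (simp add: BigAnd_def)
qed

lemma BigAndR:
  assumes "\<And>\<phi>. \<phi> \<in># M \<Longrightarrow> \<Gamma> \<turnstile> {#\<phi>#}"
  shows "\<Gamma> \<turnstile> {#BigAnd M#}"
proof -
  have "(\<And>\<phi>. \<phi> \<in> set xs \<Longrightarrow> \<Gamma> \<turnstile> {#\<phi>#}) \<Longrightarrow> \<Gamma> \<turnstile> {#foldr And xs Top#}" for xs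
    by (induction xs) (auto intro: Top_derivable G4WK.AndR)
  from this[of "list_of_mset M"] assms show ?thesis
    by (simp add: BigAnd_def flip: set_mset_mset)
qed

lemma BigOrL:
  assumes "\<And>\<phi>. \<phi> \<in># M \<Longrightarrow> add_mset \<phi> \<Gamma> \<turnstile> \<Delta>" "size \<Delta> \<le> 1"
  shows "add_mset (BigOr M) \<Gamma> \<turnstile> \<Delta>"
proof -
  have "(\<And>\<phi>. \<phi> \<in> set xs \<Longrightarrow> add_mset \<phi> \<Gamma> \<turnstile> \<Delta>) \<Longrightarrow> add_mset (foldr Or xs \<^bold>\<bottom>) \<Gamma> \<turnstile> \<Delta>" for xs
    using \<open>size \<Delta> \<le> 1\<close> by (induction xs) (auto intro: G4WK.BotL G4WK.OrL)
  from this[of "list_of_mset M"] assms show ?thesis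
    by (simp add: BigOr_def flip: set_mset_mset)
qed

lemma BigOrR:
  assumes "\<phi> \<in># M" "\<Gamma> \<turnstile> {#\<phi>#}"
  shows "\<Gamma> \<turnstile> {#BigOr M#}"
proof -
  have "\<phi> \<in> set xs \<Longrightarrow> \<Gamma> \<turnstile> {#foldr Or xs \<^bold>\<bottom>#}" for xs
    using assms(2) by (induction xs) (auto intro: G4WK.OrR1 G4WK.OrR2)
  from this[of "list_of_mset M"] assms(1) show ?thesis
    by (simp add: BigOr_def flip: set_mset_mset)
qed

section \<open>A termination measure\<close>

primrec weight :: "fm \<Rightarrow> nat" where
  "weight (Var q) = 1"
| "weight \<^bold>\<bottom> = 1"
| "weight (\<phi> \<^bold>\<and> \<psi>) = 9 * weight \<phi> * weight \<psi>"
| "weight (\<phi> \<^bold>\<or> \<psi>) = 3 * weight \<phi> * weight \<psi>"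
| "weight (\<phi> \<^bold>\<rightarrow> \<psi>) = 3 * weight \<phi> * weight \<psi>"
| "weight (\<^bold>\<box> \<phi>) = 3 * weight \<phi>"
| "weight (\<^bold>\<diamond> \<phi>) = 3 * weight \<phi>"

definition mweight :: "fm multiset \<Rightarrow> nat" where
  "mweight \<Gamma> = (\<Sum>\<phi>\<in>#\<Gamma>. weight \<phi>)"

lemma mweight_empty [simp]: "mweight {#} = 0"
  and mweight_add [simp]: "mweight (add_mset \<phi> \<Gamma>) = weight \<phi> + mweight \<Gamma>"
  by (simp_all add: mweight_def)

lemma weight_pos [simp]: "0 < weight \<phi>"
  by (induction \<phi>) auto

lemma mweight_box_inv: "mweight (box_inv \<Gamma>) \<le> mweight \<Gamma>"
proof (induction \<Gamma>)
  case (add \<phi> \<Gamma>)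
  then show ?case by (cases \<phi>) auto
qed simp

lemma mweight_dia_inv: "mweight (dia_inv \<Gamma>) \<le> mweight \<Gamma>"
proof (induction \<Gamma>)
  case (add \<phi> \<Gamma>)
  then show ?case by (cases \<phi>) auto
qed simp

text \<open>Strictness can fail only for the empty \<Gamma>. The hypothesis is phrased through
  \<open>box_inv \<Gamma>\<close> because the modal cases split on whether anything of \<Gamma>
  survives.\<close>

lemma mweight_box_inv_less: "box_inv \<Gamma> \<noteq> {#} \<Longrightarrow> mweight (box_inv \<Gamma>) < mweight \<Gamma>"
proof (induction \<Gamma>)
  case (add \<phi> \<Gamma>)
  with mweight_box_inv[of \<Gamma>] weight_pos show ?case by (cases \<phi>) (auto simp: less_Suc_eq_le add_less_le_mono)
qed simp

lemma mweight_dia_inv_less: "dia_inv \<Gamma> \<noteq> {#} \<Longrightarrow> mweight (dia_inv \<Gamma>) < mweight \<Gamma>"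
proof (induction \<Gamma>)
  case (add \<phi> \<Gamma>)
  with mweight_dia_inv[of \<Gamma>] weight_pos show ?case by (cases \<phi>) (auto simp: less_Suc_eq_le add_less_le_mono)
qed simp

lemma add_le_two_mult: "0 < a \<Longrightarrow> 0 < b \<Longrightarrow> a + b \<le> 2 * (a * b)" for a b :: nat
  by (cases a; cases b) simp_all

text \<open>One inequality for each kind of principal formula. In the sixth, the two implications on
  the left-hand side lie on opposite sides of the first premise of \<open>ImpImpL\<close>. The fifth
  and sixth compare at most 6abc with 9abc, by \<open>add_le_two_mult\<close>.\<close>

lemma weight_decreasing:
  "weight \<phi> + weight \<psi> < weight (\<phi> \<^bold>\<and> \<psi>)"
  "weight \<phi> + weight \<psi> < weight (\<phi> \<^bold>\<or> \<psi>)"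
  "weight \<phi> + weight \<psi> < weight (\<phi> \<^bold>\<rightarrow> \<psi>)"
  "weight (\<phi> \<^bold>\<rightarrow> (\<psi> \<^bold>\<rightarrow> \<chi>)) < weight ((\<phi> \<^bold>\<and> \<psi>) \<^bold>\<rightarrow> \<chi>)"
  "weight (\<phi> \<^bold>\<rightarrow> \<chi>) + weight (\<psi> \<^bold>\<rightarrow> \<chi>) < weight ((\<phi> \<^bold>\<or> \<psi>) \<^bold>\<rightarrow> \<chi>)"
  "weight (\<phi> \<^bold>\<rightarrow> \<psi>) + weight (\<psi> \<^bold>\<rightarrow> \<chi>) < weight ((\<phi> \<^bold>\<rightarrow> \<psi>) \<^bold>\<rightarrow> \<chi>)"
  "weight \<phi> < weight (\<^bold>\<box> \<phi>)"
  "weight \<phi> < weight (\<^bold>\<diamond> \<phi>)"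
proof -
  define a b c where abc: "a = weight \<phi>" "b = weight \<psi>" "c = weight \<chi>"
  have pos: "0 < a" "0 < b" "0 < c" "0 < a * b" "0 < a * b * c"
    by (simp_all add: abc)
  have ab: "a + b \<le> 2 * (a * b)"
    using pos by (intro add_le_two_mult)
  have "(a + b) * c \<le> 2 * (a * b) * c" "(a + c) * b \<le> 2 * (a * c) * b"
    using pos by (intro mult_right_mono add_le_two_mult; simp)+
  then have abc': "a * c + b * c \<le> 2 * (a * b * c)" "a * b + b * c \<le> 2 * (a * b * c)"
    by (simp_all add: algebra_simps)
  show "weight \<phi> + weight \<psi> < weight (\<phi> \<^bold>\<and> \<psi>)" "weight \<phi> + weight \<psi> < weight (\<phi> \<^bold>\<or> \<psi>)"
    "weight \<phi> + weight \<psi> < weight (\<phi> \<^bold>\<rightarrow> \<psi>)"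
    using ab pos by (simp_all flip: abc)
  show "weight (\<phi> \<^bold>\<rightarrow> (\<psi> \<^bold>\<rightarrow> \<chi>)) < weight ((\<phi> \<^bold>\<and> \<psi>) \<^bold>\<rightarrow> \<chi>)"
    using pos by (simp add: abc mult.assoc)
  have "3 * (a * c) + 3 * (b * c) < 9 * (a * b * c)" "3 * (a * b) + 3 * (b * c) < 9 * (a * b * c)"
    using abc' pos(5) by linarith+
  then show "weight (\<phi> \<^bold>\<rightarrow> \<chi>) + weight (\<psi> \<^bold>\<rightarrow> \<chi>) < weight ((\<phi> \<^bold>\<or> \<psi>) \<^bold>\<rightarrow> \<chi>)"
    "weight (\<phi> \<^bold>\<rightarrow> \<psi>) + weight (\<psi> \<^bold>\<rightarrow> \<chi>) < weight ((\<phi> \<^bold>\<rightarrow> \<psi>) \<^bold>\<rightarrow> \<chi>)"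
    by (simp_all add: mult.assoc flip: abc)
qed simp_all

section \<open>The interpolants\<close>

text \<open>The last conjunct of \<open>is_A\<close> does not mention \<open>E\<close> and is stronger than the uniformity asked of
  \<open>A\<close>: it makes the formula right adjoint to \<open>\<Gamma>\<close>. As a consequence premises can be replaced by
  their interpolants without tracking which \<open>E\<close> occurs in the context.\<close>

definition is_E :: "var \<Rightarrow> fm multiset \<Rightarrow> fm \<Rightarrow> bool" where
  "is_E p \<Gamma> e \<longleftrightarrow> vars e \<subseteq> mvars \<Gamma> - {p} \<and> (\<Gamma> \<turnstile> {#e#}) \<and>
    (\<forall>\<Pi> \<Delta>. p \<notin> mvars \<Pi> \<longrightarrow> p \<notin> mvars \<Delta> \<longrightarrow> (\<Pi> + \<Gamma> \<turnstile> \<Delta>) \<longrightarrow> (add_mset e \<Pi> \<turnstile> \<Delta>))"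

definition is_A :: "var \<Rightarrow> fm multiset \<Rightarrow> fm multiset \<Rightarrow> fm \<Rightarrow> bool" where
  "is_A p \<Gamma> \<Delta> a \<longleftrightarrow> vars a \<subseteq> (mvars \<Gamma> \<union> mvars \<Delta>) - {p} \<and> (add_mset a \<Gamma> \<turnstile> \<Delta>) \<and>
    (\<forall>\<Pi>. p \<notin> mvars \<Pi> \<longrightarrow> (\<Pi> + \<Gamma> \<turnstile> \<Delta>) \<longrightarrow> (\<Pi> \<turnstile> {#a#}))"

text \<open>Since \<open>E\<close> and \<open>A\<close> are fixed by specification alone, the
  clauses below may mention them at any argument without a termination proof; the decrease in weight
  is checked only where the specification is used.\<close>

definition E :: "var \<Rightarrow> fm multiset \<Rightarrow> fm" where
  "E p \<Gamma> = (SOME e. is_E p \<Gamma> e)"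

definition A :: "var \<Rightarrow> fm multiset \<Rightarrow> fm multiset \<Rightarrow> fm" where
  "A p \<Gamma> \<Delta> = (SOME a. is_A p \<Gamma> \<Delta> a)"

text \<open>Each clause below handles one principal formula of \<open>\<Gamma>\<close>; the second argument is that formula,
  the multiset the rest of \<open>\<Gamma>\<close>. An implication with antecedent \<open>\<^bold>\<diamond> \<phi>\<close> contributes one entry for a partner
  \<open>\<^bold>\<diamond> \<gamma>\<close> hidden in the \<open>p\<close>-free context, and one for each partner inside \<open>\<Gamma>\<close>; likewise for \<open>Var q\<close>.\<close>

fun E_conjuncts :: "var \<Rightarrow> fm \<Rightarrow> fm multiset \<Rightarrow> fm multiset" where
  "E_conjuncts p (Var q) \<Gamma> = (if q = p then {#} else {#Var q#})"
| "E_conjuncts p \<^bold>\<bottom> \<Gamma> = {#\<^bold>\<bottom>#}"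
| "E_conjuncts p (\<phi> \<^bold>\<and> \<psi>) \<Gamma> = {#E p (add_mset \<phi> (add_mset \<psi> \<Gamma>))#}"
| "E_conjuncts p (\<phi> \<^bold>\<or> \<psi>) \<Gamma> = {#E p (add_mset \<phi> \<Gamma>) \<^bold>\<or> E p (add_mset \<psi> \<Gamma>)#}"
| "E_conjuncts p (Var q \<^bold>\<rightarrow> \<chi>) \<Gamma> =
    (if q = p then {#} else {#Var q \<^bold>\<rightarrow> E p (add_mset \<chi> \<Gamma>)#}) +
    (if Var q \<in># \<Gamma> then {#E p (add_mset \<chi> \<Gamma>)#} else {#})"
| "E_conjuncts p (\<^bold>\<bottom> \<^bold>\<rightarrow> \<chi>) \<Gamma> = {#}"
| "E_conjuncts p ((\<phi> \<^bold>\<and> \<psi>) \<^bold>\<rightarrow> \<chi>) \<Gamma> = {#E p (add_mset (\<phi> \<^bold>\<rightarrow> (\<psi> \<^bold>\<rightarrow> \<chi>)) \<Gamma>)#}"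
| "E_conjuncts p ((\<phi> \<^bold>\<or> \<psi>) \<^bold>\<rightarrow> \<chi>) \<Gamma> = {#E p (add_mset (\<phi> \<^bold>\<rightarrow> \<chi>) (add_mset (\<psi> \<^bold>\<rightarrow> \<chi>) \<Gamma>))#}"
| "E_conjuncts p ((\<phi> \<^bold>\<rightarrow> \<psi>) \<^bold>\<rightarrow> \<chi>) \<Gamma> =
    {#A p (add_mset (\<psi> \<^bold>\<rightarrow> \<chi>) \<Gamma>) {#\<phi> \<^bold>\<rightarrow> \<psi>#} \<^bold>\<rightarrow> E p (add_mset \<chi> \<Gamma>)#}"
| "E_conjuncts p (\<^bold>\<box> \<phi> \<^bold>\<rightarrow> \<chi>) \<Gamma> =
    {#\<^bold>\<box> (A p (box_inv \<Gamma>) {#\<phi>#}) \<^bold>\<rightarrow> E p (add_mset \<chi> \<Gamma>)#}"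
| "E_conjuncts p (\<^bold>\<diamond> \<phi> \<^bold>\<rightarrow> \<chi>) \<Gamma> =
    add_mset (\<^bold>\<diamond> (A p (box_inv \<Gamma>) {#\<phi>#}) \<^bold>\<rightarrow> E p (add_mset \<chi> \<Gamma>))
      {#\<^bold>\<box> (A p (add_mset \<gamma> (box_inv \<Gamma>)) {#\<phi>#}) \<^bold>\<rightarrow> E p (add_mset \<chi> \<Gamma>). \<gamma> \<in># dia_inv \<Gamma>#}"
| "E_conjuncts p (\<^bold>\<box> \<phi>) \<Gamma> = {#\<^bold>\<box> (E p (add_mset \<phi> (box_inv \<Gamma>)))#}"
| "E_conjuncts p (\<^bold>\<diamond> \<phi>) \<Gamma> = {#\<^bold>\<diamond> (E p (add_mset \<phi> (box_inv \<Gamma>)))#}"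

fun A_left :: "var \<Rightarrow> fm \<Rightarrow> fm multiset \<Rightarrow> fm multiset \<Rightarrow> fm multiset" where
  "A_left p (Var q) \<Gamma> \<Delta> = (if \<Delta> = {#Var q#} then {#Top#} else {#})"
| "A_left p \<^bold>\<bottom> \<Gamma> \<Delta> = {#Top#}"
| "A_left p (\<phi> \<^bold>\<and> \<psi>) \<Gamma> \<Delta> = {#A p (add_mset \<phi> (add_mset \<psi> \<Gamma>)) \<Delta>#}"
| "A_left p (\<phi> \<^bold>\<or> \<psi>) \<Gamma> \<Delta> = {#A p (add_mset \<phi> \<Gamma>) \<Delta> \<^bold>\<and> A p (add_mset \<psi> \<Gamma>) \<Delta>#}"
| "A_left p (Var q \<^bold>\<rightarrow> \<chi>) \<Gamma> \<Delta> =
    (if q = p then {#} else {#Var q \<^bold>\<and> A p (add_mset \<chi> \<Gamma>) \<Delta>#}) +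
    (if Var q \<in># \<Gamma> then {#A p (add_mset \<chi> \<Gamma>) \<Delta>#} else {#})"
| "A_left p (\<^bold>\<bottom> \<^bold>\<rightarrow> \<chi>) \<Gamma> \<Delta> = {#}"
| "A_left p ((\<phi> \<^bold>\<and> \<psi>) \<^bold>\<rightarrow> \<chi>) \<Gamma> \<Delta> = {#A p (add_mset (\<phi> \<^bold>\<rightarrow> (\<psi> \<^bold>\<rightarrow> \<chi>)) \<Gamma>) \<Delta>#}"
| "A_left p ((\<phi> \<^bold>\<or> \<psi>) \<^bold>\<rightarrow> \<chi>) \<Gamma> \<Delta> =
    {#A p (add_mset (\<phi> \<^bold>\<rightarrow> \<chi>) (add_mset (\<psi> \<^bold>\<rightarrow> \<chi>) \<Gamma>)) \<Delta>#}"
| "A_left p ((\<phi> \<^bold>\<rightarrow> \<psi>) \<^bold>\<rightarrow> \<chi>) \<Gamma> \<Delta> =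
    {#A p (add_mset (\<psi> \<^bold>\<rightarrow> \<chi>) \<Gamma>) {#\<phi> \<^bold>\<rightarrow> \<psi>#} \<^bold>\<and> A p (add_mset \<chi> \<Gamma>) \<Delta>#}"
| "A_left p (\<^bold>\<box> \<phi> \<^bold>\<rightarrow> \<chi>) \<Gamma> \<Delta> =
    {#\<^bold>\<box> (A p (box_inv \<Gamma>) {#\<phi>#}) \<^bold>\<and> A p (add_mset \<chi> \<Gamma>) \<Delta>#}"
| "A_left p (\<^bold>\<diamond> \<phi> \<^bold>\<rightarrow> \<chi>) \<Gamma> \<Delta> =
    add_mset (\<^bold>\<diamond> (A p (box_inv \<Gamma>) {#\<phi>#}) \<^bold>\<and> A p (add_mset \<chi> \<Gamma>) \<Delta>)
      {#\<^bold>\<box> (A p (add_mset \<gamma> (box_inv \<Gamma>)) {#\<phi>#}) \<^bold>\<and> A p (add_mset \<chi> \<Gamma>) \<Delta>. \<gamma> \<in># dia_inv \<Gamma>#}"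
| "A_left p (\<^bold>\<box> \<phi>) \<Gamma> \<Delta> = {#}"
| "A_left p (\<^bold>\<diamond> \<phi>) \<Gamma> \<Delta> = {#\<^bold>\<box> (A p (add_mset \<phi> (box_inv \<Gamma>)) (dia_inv \<Delta>))#}"

text \<open>A diamond on the right gives no disjunct here: only \<open>DiaL\<close> strips it, and
  its principal formula is on the left, in \<Gamma> (see \<open>A_left\<close>) or in the context
  (see the last summand of \<open>A_disjuncts\<close>). For \<open>Var p\<close> an axiom must take
  its left occurrence from \<Gamma>, so \<open>A_left\<close> supplies \<open>Top\<close>.\<close>

fun A_right :: "var \<Rightarrow> fm multiset \<Rightarrow> fm \<Rightarrow> fm multiset" where
  "A_right p \<Gamma> (Var q) = (if q = p then {#} else {#Var q#})"
| "A_right p \<Gamma> \<^bold>\<bottom> = {#}"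
| "A_right p \<Gamma> (\<phi> \<^bold>\<and> \<psi>) = {#A p \<Gamma> {#\<phi>#} \<^bold>\<and> A p \<Gamma> {#\<psi>#}#}"
| "A_right p \<Gamma> (\<phi> \<^bold>\<or> \<psi>) = {#A p \<Gamma> {#\<phi>#}, A p \<Gamma> {#\<psi>#}#}"
| "A_right p \<Gamma> (\<phi> \<^bold>\<rightarrow> \<psi>) = {#A p (add_mset \<phi> \<Gamma>) {#\<psi>#}#}"
| "A_right p \<Gamma> (\<^bold>\<box> \<phi>) = {#\<^bold>\<box> (A p (box_inv \<Gamma>) {#\<phi>#})#}"
| "A_right p \<Gamma> (\<^bold>\<diamond> \<phi>) = {#}"

definition E_context :: "var \<Rightarrow> fm multiset \<Rightarrow> fm multiset" where
  "E_context p \<Gamma> = (\<Sum>\<phi>\<in>#\<Gamma>. E_conjuncts p \<phi> (\<Gamma> - {#\<phi>#}))"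

text \<open>The last summand accounts for \<open>DiaL\<close> with principal formula in the \<open>p\<close>-free context. When its
  guard fails, no part of \<open>\<Gamma>\<close> and \<open>\<Delta>\<close> survives in the premise, and the conclusion is derivable
  without it.\<close>

definition A_disjuncts :: "var \<Rightarrow> fm multiset \<Rightarrow> fm multiset \<Rightarrow> fm multiset" where
  "A_disjuncts p \<Gamma> \<Delta> =
    (\<Sum>\<phi>\<in>#\<Gamma>. A_left p \<phi> (\<Gamma> - {#\<phi>#}) \<Delta>) + (\<Sum>\<phi>\<in>#\<Delta>. A_right p \<Gamma> \<phi>) +
    (if mweight (box_inv \<Gamma>) + mweight (dia_inv \<Delta>) < mweight \<Gamma> + mweight \<Delta>
     then {#\<^bold>\<diamond> (A p (box_inv \<Gamma>) (dia_inv \<Delta>))#} else {#})"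

lemma in_E_context: "c \<in># E_conjuncts p \<phi> \<Gamma> \<Longrightarrow> c \<in># E_context p (add_mset \<phi> \<Gamma>)"
  by (simp add: E_context_def)

lemma in_E_contextE:
  assumes "c \<in># E_context p \<Gamma>"
  obtains \<phi> \<Gamma>' where "\<Gamma> = add_mset \<phi> \<Gamma>'" "c \<in># E_conjuncts p \<phi> \<Gamma>'"
  using assms unfolding E_context_def
  by (auto simp: dest!: multi_member_split)

lemma in_A_disjuncts_left: "c \<in># A_left p \<phi> \<Gamma> \<Delta> \<Longrightarrow> c \<in># A_disjuncts p (add_mset \<phi> \<Gamma>) \<Delta>"
  and in_A_disjuncts_right: "c \<in># A_right p \<Gamma> \<phi> \<Longrightarrow> c \<in># A_disjuncts p \<Gamma> {#\<phi>#}"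
  by (simp_all add: A_disjuncts_def)

lemma in_A_disjunctsE:
  assumes "c \<in># A_disjuncts p \<Gamma> \<Delta>"
  obtains (left) \<phi> \<Gamma>' where "\<Gamma> = add_mset \<phi> \<Gamma>'" "c \<in># A_left p \<phi> \<Gamma>' \<Delta>"
  | (right) \<phi> where "\<phi> \<in># \<Delta>" "c \<in># A_right p \<Gamma> \<phi>"
  | (dia) "mweight (box_inv \<Gamma>) + mweight (dia_inv \<Delta>) < mweight \<Gamma> + mweight \<Delta>"
      "c = \<^bold>\<diamond> (A p (box_inv \<Gamma>) (dia_inv \<Delta>))"
proof -
  consider \<phi> where "\<phi> \<in># \<Gamma>" "c \<in># A_left p \<phi> (\<Gamma> - {#\<phi>#}) \<Delta>"
    | \<phi> where "\<phi> \<in># \<Delta>" "c \<in># A_right p \<Gamma> \<phi>"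
    | "mweight (box_inv \<Gamma>) + mweight (dia_inv \<Delta>) < mweight \<Gamma> + mweight \<Delta>"
      "c = \<^bold>\<diamond> (A p (box_inv \<Gamma>) (dia_inv \<Delta>))"
    using assms unfolding A_disjuncts_def by (auto split: if_splits)
  then show thesis
  proof cases
    case (1 \<phi>)
    then show ?thesis
      by (intro left[of \<phi> "\<Gamma> - {#\<phi>#}"]) simp_all
  qed (fact right dia)+
qed

section \<open>Soundness of the conjuncts and disjuncts\<close>

text \<open>The hypothesis of the outer induction, for a fixed \<open>p\<close>. The facts proved in
  it concern sequents of weight up to and including \<open>N\<close>.\<close>

locale interpolants_below =
  fixes p :: var and N :: nat
  assumes is_E: "mweight \<Gamma> < N \<Longrightarrow> is_E p \<Gamma> (E p \<Gamma>)"
    and is_A: "size \<Delta> \<le> 1 \<Longrightarrow> mweight \<Gamma> + mweight \<Delta> < N \<Longrightarrow> is_A p \<Gamma> \<Delta> (A p \<Gamma> \<Delta>)"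
begin

lemma
  assumes "mweight \<Gamma> < N"
  shows E_vars: "vars (E p \<Gamma>) \<subseteq> mvars \<Gamma> - {p}"
    and E_derivable: "\<Gamma> \<turnstile> {#E p \<Gamma>#}"
    and E_uniform: "p \<notin> mvars \<Pi> \<Longrightarrow> p \<notin> mvars \<Theta> \<Longrightarrow> \<Pi> + \<Gamma> \<turnstile> \<Theta> \<Longrightarrow> add_mset (E p \<Gamma>) \<Pi> \<turnstile> \<Theta>"
  using is_E[OF assms] unfolding is_E_def by blast+

lemma
  assumes "size \<Delta> \<le> 1" "mweight \<Gamma> + mweight \<Delta> < N"
  shows A_vars: "vars (A p \<Gamma> \<Delta>) \<subseteq> (mvars \<Gamma> \<union> mvars \<Delta>) - {p}"
    and A_derivable: "add_mset (A p \<Gamma> \<Delta>) \<Gamma> \<turnstile> \<Delta>"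
    and A_uniform: "p \<notin> mvars \<Pi> \<Longrightarrow> \<Pi> + \<Gamma> \<turnstile> \<Delta> \<Longrightarrow> \<Pi> \<turnstile> {#A p \<Gamma> \<Delta>#}"
  using is_A[OF assms] unfolding is_A_def by blast+

text \<open>The bound is \<le> rather than < because each clause uses interpolants only of sequents
  strictly lighter than the one at hand. Each conjunct is derived by the rule that its clause
  imitates, followed by \<open>ImpR\<close> if it has a guard.\<close>

lemma E_conjuncts_sound:
  assumes "c \<in># E_conjuncts p \<alpha> \<Gamma>" "weight \<alpha> + mweight \<Gamma> \<le> N"
  shows "vars c \<subseteq> mvars (add_mset \<alpha> \<Gamma>) - {p} \<and> (add_mset \<alpha> \<Gamma> \<turnstile> {#c#})"
proof (cases "(p, \<alpha>, \<Gamma>)" rule: E_conjuncts.cases)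
  case (1 p q \<Gamma>)
  with assms show ?thesis
    by (auto split: if_splits intro!: G4WK.IdP)
next
  case (2 p \<Gamma>)
  with assms show ?thesis
    by (auto intro!: G4WK.BotL)
next
  case (3 p' \<phi> \<psi> \<Gamma>')
  let ?\<Gamma> = "add_mset \<phi> (add_mset \<psi> \<Gamma>)"
  have "mweight ?\<Gamma> < N"
    using assms(2) 3 weight_decreasing(1)[of \<phi> \<psi>] by simp
  with assms(1) 3 E_vars[of ?\<Gamma>] E_derivable[of ?\<Gamma>] show ?thesis
    by (auto intro!: G4WK.AndL)
next
  case (4 p' \<phi> \<psi> \<Gamma>')
  let ?\<phi> = "add_mset \<phi> \<Gamma>" and ?\<psi> = "add_mset \<psi> \<Gamma>"
  have "mweight ?\<phi> < N" "mweight ?\<psi> < N"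
    using assms(2) 4 weight_decreasing(2)[of \<phi> \<psi>] by simp_all
  with assms(1) 4 E_vars[of ?\<phi>] E_derivable[of ?\<phi>] E_vars[of ?\<psi>] E_derivable[of ?\<psi>]
  show ?thesis
    by (auto intro!: G4WK.OrL intro: G4WK.OrR1 G4WK.OrR2)
next
  case (5 p' q \<chi> \<Gamma>')
  let ?\<chi> = "add_mset \<chi> \<Gamma>"
  have "mweight ?\<chi> < N"
    using assms(2) 5 weight_decreasing(3)[of "Var q" \<chi>] by simp
  note E = E_vars[OF this] E_derivable[OF this]
  consider "q \<noteq> p" "c = Var q \<^bold>\<rightarrow> E p ?\<chi>" | "Var q \<in># \<Gamma>" "c = E p ?\<chi>"
    using assms(1) 5 by (auto split: if_splits)
  then show ?thesis
  proof cases
    case 1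
    have "add_mset (Var q) (add_mset \<chi> \<Gamma>) \<turnstile> {#E p ?\<chi>#}"
      using weakening1[OF E(2)] .
    then have "add_mset (Var q) (add_mset (Var q \<^bold>\<rightarrow> \<chi>) \<Gamma>) \<turnstile> {#E p ?\<chi>#}"
      by (intro G4WK.VarImpL) simp_all
    with 1 5 E(1) show ?thesis
      by (auto intro!: G4WK.ImpR)
  next
    case 2
    then obtain \<Gamma>'' where \<Gamma>'': "\<Gamma> = add_mset (Var q) \<Gamma>''"
      by (auto dest: multi_member_split)
    with E(2) have "add_mset (Var q) (add_mset (Var q \<^bold>\<rightarrow> \<chi>) \<Gamma>'') \<turnstile> {#E p ?\<chi>#}"
      by (intro G4WK.VarImpL) (simp_all add: add_mset_commute)
    with 2 5 E(1) \<Gamma>'' show ?thesis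
      by (auto simp: add_mset_commute)
  qed
next
  case (6 p' \<chi> \<Gamma>')
  with assms show ?thesis by simp
next
  case (7 p' \<phi> \<psi> \<chi> \<Gamma>')
  let ?\<Gamma> = "add_mset (\<phi> \<^bold>\<rightarrow> (\<psi> \<^bold>\<rightarrow> \<chi>)) \<Gamma>"
  have "mweight ?\<Gamma> < N"
    using assms(2) 7 weight_decreasing(4)[of \<phi> \<psi> \<chi>] by (simp del: weight.simps)
  with assms(1) 7 E_vars[of ?\<Gamma>] E_derivable[of ?\<Gamma>] show ?thesis
    by (auto intro!: G4WK.AndImpL)
next
  case (8 p' \<phi> \<psi> \<chi> \<Gamma>')
  let ?\<Gamma> = "add_mset (\<phi> \<^bold>\<rightarrow> \<chi>) (add_mset (\<psi> \<^bold>\<rightarrow> \<chi>) \<Gamma>)"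
  have "mweight ?\<Gamma> < N"
    using assms(2) 8 weight_decreasing(5)[of \<phi> \<chi> \<psi>] by simp
  with assms(1) 8 E_vars[of ?\<Gamma>] E_derivable[of ?\<Gamma>] show ?thesis
    by (auto intro!: G4WK.OrImpL)
next
  case (9 p' \<phi> \<psi> \<chi> \<Gamma>')
  let ?a = "A p (add_mset (\<psi> \<^bold>\<rightarrow> \<chi>) \<Gamma>) {#\<phi> \<^bold>\<rightarrow> \<psi>#}" and ?e = "E p (add_mset \<chi> \<Gamma>)"
  have "mweight (add_mset (\<psi> \<^bold>\<rightarrow> \<chi>) \<Gamma>) + mweight {#\<phi> \<^bold>\<rightarrow> \<psi>#} < N"
    using assms(2) 9 weight_decreasing(6)[of \<phi> \<psi> \<chi>] by simp
  note A = A_vars[OF _ this] A_derivable[OF _ this]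
  have "mweight (add_mset \<chi> \<Gamma>) < N"
    using assms(2) 9 weight_decreasing(3)[of "\<phi> \<^bold>\<rightarrow> \<psi>" \<chi>] by simp
  note E = E_vars[OF this] E_derivable[OF this]
  have "add_mset (\<psi> \<^bold>\<rightarrow> \<chi>) (add_mset ?a \<Gamma>) \<turnstile> {#\<phi> \<^bold>\<rightarrow> \<psi>#}" "add_mset \<chi> (add_mset ?a \<Gamma>) \<turnstile> {#?e#}"
    using A(2) weakening1[OF E(2), of ?a] by (simp_all add: add_mset_commute)
  then have "add_mset ((\<phi> \<^bold>\<rightarrow> \<psi>) \<^bold>\<rightarrow> \<chi>) (add_mset ?a \<Gamma>) \<turnstile> {#?e#}"
    by (intro G4WK.ImpImpL) simp_all
  with assms(1) 9 A(1) E(1) show ?thesis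
    by (auto simp: add_mset_commute intro!: G4WK.ImpR)
next
  case (10 p' \<phi> \<chi> \<Gamma>')
  let ?a = "A p (box_inv \<Gamma>) {#\<phi>#}" and ?e = "E p (add_mset \<chi> \<Gamma>)"
  have "mweight (box_inv \<Gamma>) + mweight {#\<phi>#} < N" "mweight (add_mset \<chi> \<Gamma>) < N"
    using assms(2) 10 weight_decreasing(3)[of "\<^bold>\<box> \<phi>" \<chi>] mweight_box_inv[of \<Gamma>] by simp_all
  note A = A_vars[OF _ this(1)] A_derivable[OF _ this(1)]
    and E = E_vars[OF this(2)] E_derivable[OF this(2)]
  \<comment> \<open>The guard is boxed so that passing to the modal premise releases
    \<open>?a\<close> there.\<close>
  have "box_inv (add_mset (\<^bold>\<box> ?a) \<Gamma>) \<turnstile> {#\<phi>#}" "add_mset \<chi> (add_mset (\<^bold>\<box> ?a) \<Gamma>) \<turnstile> {#?e#}"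
    using A(2) weakening1[OF E(2), of "\<^bold>\<box> ?a"] by (simp_all add: add_mset_commute)
  then have "add_mset (\<^bold>\<box> \<phi> \<^bold>\<rightarrow> \<chi>) (add_mset (\<^bold>\<box> ?a) \<Gamma>) \<turnstile> {#?e#}"
    by (intro G4WK.BoxImpL) simp_all
  with assms(1) 10 A(1) E(1) mvars_box_inv[of \<Gamma>] show ?thesis
    by (auto simp: add_mset_commute intro!: G4WK.ImpR)
next
  case (11 p' \<phi> \<chi> \<Gamma>')
  let ?e = "E p (add_mset \<chi> \<Gamma>)"
  have "mweight (add_mset \<chi> \<Gamma>) < N"
    using assms(2) 11 weight_decreasing(3)[of "\<^bold>\<diamond> \<phi>" \<chi>] by simp
  note E = E_vars[OF this] E_derivable[OF this]
  consider "c = \<^bold>\<diamond> (A p (box_inv \<Gamma>) {#\<phi>#}) \<^bold>\<rightarrow> ?e"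
    | \<gamma> where "\<^bold>\<diamond> \<gamma> \<in># \<Gamma>" "c = \<^bold>\<box> (A p (add_mset \<gamma> (box_inv \<Gamma>)) {#\<phi>#}) \<^bold>\<rightarrow> ?e"
    using assms(1) 11 by auto
  then show ?thesis
  proof cases
    case 1
    let ?a = "A p (box_inv \<Gamma>) {#\<phi>#}"
    have "mweight (box_inv \<Gamma>) + mweight {#\<phi>#} < N"
      using assms(2) 11 weight_decreasing(3)[of "\<^bold>\<diamond> \<phi>" \<chi>] mweight_box_inv[of \<Gamma>] by simp
    note A = A_vars[OF _ this] A_derivable[OF _ this]
    \<comment> \<open>The guard itself plays the partner diamond of \<open>DiaImpL\<close>, with
      \<open>?a\<close> in the role of \<gamma>.\<close>
    have "add_mset (\<^bold>\<diamond> ?a) (add_mset \<chi> \<Gamma>) \<turnstile> {#?e#}"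
      using weakening1[OF E(2)] .
    with A(2) have "add_mset (\<^bold>\<diamond> ?a) (add_mset (\<^bold>\<diamond> \<phi> \<^bold>\<rightarrow> \<chi>) \<Gamma>) \<turnstile> {#?e#}"
      by (intro G4WK.DiaImpL) simp_all
    with 1 11 A(1) E(1) mvars_box_inv[of \<Gamma>] show ?thesis
      by (auto intro!: G4WK.ImpR)
  next
    case (2 \<gamma>)
    let ?a = "A p (add_mset \<gamma> (box_inv \<Gamma>)) {#\<phi>#}"
    have \<alpha>: "\<alpha> = \<^bold>\<diamond> \<phi> \<^bold>\<rightarrow> \<chi>"
      using 11 by simp
    obtain \<Gamma>'' where \<Gamma>'': "\<Gamma> = add_mset (\<^bold>\<diamond> \<gamma>) \<Gamma>''"
      using 2 by (auto dest: multi_member_split)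
    have "mweight (add_mset \<gamma> (box_inv \<Gamma>)) + mweight {#\<phi>#} < N"
      using assms(2) \<alpha> \<Gamma>'' weight_decreasing(3)[of "\<^bold>\<diamond> \<phi>" \<chi>] mweight_box_inv[of \<Gamma>''] by simp
    note A = A_vars[OF _ this] A_derivable[OF _ this]
    \<comment> \<open>With the partner inside \<Gamma>, the diamond is already spent on \<gamma>, so
      \<open>?a\<close> can enter the modal premise only from under a box.\<close>
    have "add_mset (\<^bold>\<diamond> \<gamma>) (add_mset \<chi> (add_mset (\<^bold>\<box> ?a) \<Gamma>'')) \<turnstile> {#?e#}"
      using weakening1[OF E(2), of "\<^bold>\<box> ?a"] \<Gamma>'' by (simp add: add_mset_commute)
    moreover have "add_mset \<gamma> (box_inv (add_mset (\<^bold>\<box> ?a) \<Gamma>'')) \<turnstile> {#\<phi>#}"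
      using A(2) \<Gamma>'' by (simp add: add_mset_commute)
    ultimately have
      "add_mset (\<^bold>\<diamond> \<gamma>) (add_mset (\<^bold>\<diamond> \<phi> \<^bold>\<rightarrow> \<chi>) (add_mset (\<^bold>\<box> ?a) \<Gamma>'')) \<turnstile> {#?e#}"
      by (intro G4WK.DiaImpL) simp_all
    moreover have "add_mset (\<^bold>\<diamond> \<gamma>) (add_mset (\<^bold>\<diamond> \<phi> \<^bold>\<rightarrow> \<chi>) (add_mset (\<^bold>\<box> ?a) \<Gamma>'')) =
        add_mset (\<^bold>\<box> ?a) (add_mset (\<^bold>\<diamond> \<phi> \<^bold>\<rightarrow> \<chi>) \<Gamma>)"
      by (simp add: \<Gamma>'' add_mset_commute)
    ultimately have "add_mset (\<^bold>\<diamond> \<phi> \<^bold>\<rightarrow> \<chi>) \<Gamma> \<turnstile> {#c#}"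
      using 2(2) by (auto intro: G4WK.ImpR)
    moreover have vars: "vars ?a \<subseteq> vars \<gamma> \<union> mvars \<Gamma>'' \<union> vars \<phi> - {p}"
      using A(1) \<Gamma>'' mvars_box_inv[of \<Gamma>''] by fastforce
    ultimately show ?thesis
      using 2 11 E(1) \<Gamma>''
      by auto
  qed
next
  case (12 p' \<phi> \<Gamma>')
  let ?\<Gamma> = "add_mset \<phi> (box_inv \<Gamma>)"
  have "mweight ?\<Gamma> < N"
    using assms(2) 12 mweight_box_inv[of \<Gamma>] weight_decreasing(7,8)[of \<phi>] by (simp del: weight.simps)
  with assms(1) 12 E_vars[of ?\<Gamma>] E_derivable[of ?\<Gamma>] mvars_box_inv[of \<Gamma>] show ?thesis
    by (auto intro!: G4WK.BoxR)
next
  case (13 p' \<phi> \<Gamma>')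
  let ?\<Gamma> = "add_mset \<phi> (box_inv \<Gamma>)"
  have "mweight ?\<Gamma> < N"
    using assms(2) 13 mweight_box_inv[of \<Gamma>] weight_decreasing(7,8)[of \<phi>] by (simp del: weight.simps)
  with assms(1) 13 E_vars[of ?\<Gamma>] E_derivable[of ?\<Gamma>] mvars_box_inv[of \<Gamma>] show ?thesis
    by (auto intro!: G4WK.DiaL)
qed

text \<open>The dual of \<open>E_conjuncts_sound\<close>: a guarded disjunct stands on the left,
  where \<open>AndL\<close> splits it into the guard and the interpolant of the other
  premise.\<close>

lemma A_left_sound:
  assumes "c \<in># A_left p \<alpha> \<Gamma> \<Delta>" "weight \<alpha> + mweight \<Gamma> + mweight \<Delta> \<le> N" "size \<Delta> \<le> 1"
  shows "vars c \<subseteq> mvars (add_mset \<alpha> \<Gamma>) \<union> mvars \<Delta> - {p} \<and> (add_mset c (add_mset \<alpha> \<Gamma>) \<turnstile> \<Delta>)"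
proof (cases "(p, \<alpha>, \<Gamma>, \<Delta>)" rule: A_left.cases)
  case (1 p q \<Gamma> \<Delta>)
  with assms show ?thesis
    by (auto split: if_splits intro!: G4WK.IdP weakening1)
next
  case (2 p \<Gamma> \<Delta>)
  with assms show ?thesis
    using weakening1[OF G4WK.BotL[OF assms(3)]] by auto
next
  case (3 p' \<phi> \<psi> \<Gamma>' \<Delta>')
  let ?\<Gamma> = "add_mset \<phi> (add_mset \<psi> \<Gamma>)"
  have "mweight ?\<Gamma> + mweight \<Delta> < N"
    using assms(2) 3 weight_decreasing(1)[of \<phi> \<psi>] by simp
  note A = A_vars[OF assms(3) this] A_derivable[OF assms(3) this]
  have "add_mset (\<phi> \<^bold>\<and> \<psi>) (add_mset (A p ?\<Gamma> \<Delta>) \<Gamma>) \<turnstile> \<Delta>"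
    using A(2) assms(3) by (intro G4WK.AndL) (simp_all add: add_mset_commute)
  with assms(1) 3 A(1) show ?thesis
    by (auto simp: add_mset_commute)
next
  case (4 p' \<phi> \<psi> \<Gamma>' \<Delta>')
  let ?a = "A p (add_mset \<phi> \<Gamma>) \<Delta>" and ?b = "A p (add_mset \<psi> \<Gamma>) \<Delta>"
  have *: "mweight (add_mset \<phi> \<Gamma>) + mweight \<Delta> < N" "mweight (add_mset \<psi> \<Gamma>) + mweight \<Delta> < N"
    using assms(2) 4 weight_decreasing(2)[of \<phi> \<psi>] by simp_all
  note A = A_vars[OF assms(3) *(1)] A_vars[OF assms(3) *(2)]
  have "add_mset (\<phi> \<^bold>\<or> \<psi>) (add_mset ?a (add_mset ?b \<Gamma>)) \<turnstile> \<Delta>"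
    using weakening1[OF A_derivable[OF assms(3) *(1)], of ?b]
      weakening1[OF A_derivable[OF assms(3) *(2)], of ?a] assms(3)
    by (intro G4WK.OrL) (simp_all add: add_mset_commute)
  then have "add_mset (?a \<^bold>\<and> ?b) (add_mset (\<phi> \<^bold>\<or> \<psi>) \<Gamma>) \<turnstile> \<Delta>"
    using assms(3) by (intro G4WK.AndL) (simp_all add: add_mset_commute)
  with assms(1) 4 A show ?thesis
    by auto
next
  case (5 p' q \<chi> \<Gamma>' \<Delta>')
  let ?\<chi> = "add_mset \<chi> \<Gamma>"
  let ?a = "A p ?\<chi> \<Delta>"
  have "mweight ?\<chi> + mweight \<Delta> < N"
    using assms(2) 5 weight_decreasing(3)[of "Var q" \<chi>] by simp
  note A = A_vars[OF assms(3) this] A_derivable[OF assms(3) this]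
  consider "q \<noteq> p" "c = Var q \<^bold>\<and> ?a" | "Var q \<in># \<Gamma>" "c = ?a"
    using assms(1) 5 by (auto split: if_splits)
  then show ?thesis
  proof cases
    case 1
    have "add_mset (Var q) (add_mset \<chi> (add_mset ?a \<Gamma>)) \<turnstile> \<Delta>"
      using weakening1[OF A(2), of "Var q"] by (simp add: add_mset_commute)
    then have "add_mset (Var q) (add_mset (Var q \<^bold>\<rightarrow> \<chi>) (add_mset ?a \<Gamma>)) \<turnstile> \<Delta>"
      using assms(3) by (intro G4WK.VarImpL)
    then have "add_mset (Var q \<^bold>\<and> ?a) (add_mset (Var q \<^bold>\<rightarrow> \<chi>) \<Gamma>) \<turnstile> \<Delta>"
      using assms(3) by (intro G4WK.AndL) (simp_all add: add_mset_commute)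
    with 1 5 A(1) show ?thesis
      by auto
  next
    case 2
    then obtain \<Gamma>'' where \<Gamma>'': "\<Gamma> = add_mset (Var q) \<Gamma>''"
      by (auto dest: multi_member_split)
    with A(2) assms(3)
    have "add_mset (Var q) (add_mset (Var q \<^bold>\<rightarrow> \<chi>) (add_mset ?a \<Gamma>'')) \<turnstile> \<Delta>"
      by (intro G4WK.VarImpL) (simp_all add: add_mset_commute)
    with 2 5 A(1) \<Gamma>'' show ?thesis
      by (auto simp: add_mset_commute)
  qed
next
  case (6 p' \<chi> \<Gamma>' \<Delta>')
  with assms show ?thesis by simp
next
  case (7 p' \<phi> \<psi> \<chi> \<Gamma>' \<Delta>')
  let ?\<Gamma> = "add_mset (\<phi> \<^bold>\<rightarrow> (\<psi> \<^bold>\<rightarrow> \<chi>)) \<Gamma>"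
  have "mweight ?\<Gamma> + mweight \<Delta> < N"
    using assms(2) 7 weight_decreasing(4)[of \<phi> \<psi> \<chi>] by (simp del: weight.simps)
  note A = A_vars[OF assms(3) this] A_derivable[OF assms(3) this]
  have "add_mset ((\<phi> \<^bold>\<and> \<psi>) \<^bold>\<rightarrow> \<chi>) (add_mset (A p ?\<Gamma> \<Delta>) \<Gamma>) \<turnstile> \<Delta>"
    using A(2) assms(3) by (intro G4WK.AndImpL) (simp_all add: add_mset_commute)
  with assms(1) 7 A(1) show ?thesis
    by (auto simp: add_mset_commute)
next
  case (8 p' \<phi> \<psi> \<chi> \<Gamma>' \<Delta>')
  let ?\<Gamma> = "add_mset (\<phi> \<^bold>\<rightarrow> \<chi>) (add_mset (\<psi> \<^bold>\<rightarrow> \<chi>) \<Gamma>)"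
  have "mweight ?\<Gamma> + mweight \<Delta> < N"
    using assms(2) 8 weight_decreasing(5)[of \<phi> \<chi> \<psi>] by simp
  note A = A_vars[OF assms(3) this] A_derivable[OF assms(3) this]
  have "add_mset ((\<phi> \<^bold>\<or> \<psi>) \<^bold>\<rightarrow> \<chi>) (add_mset (A p ?\<Gamma> \<Delta>) \<Gamma>) \<turnstile> \<Delta>"
    using A(2) assms(3) by (intro G4WK.OrImpL) (simp_all add: add_mset_commute)
  with assms(1) 8 A(1) show ?thesis
    by (auto simp: add_mset_commute)
next
  case (9 p' \<phi> \<psi> \<chi> \<Gamma>' \<Delta>')
  let ?a = "A p (add_mset (\<psi> \<^bold>\<rightarrow> \<chi>) \<Gamma>) {#\<phi> \<^bold>\<rightarrow> \<psi>#}" and ?b = "A p (add_mset \<chi> \<Gamma>) \<Delta>"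
  have "mweight (add_mset (\<psi> \<^bold>\<rightarrow> \<chi>) \<Gamma>) + mweight {#\<phi> \<^bold>\<rightarrow> \<psi>#} < N"
    using assms(2) 9 weight_decreasing(6)[of \<phi> \<psi> \<chi>] by simp
  note A = A_vars[OF _ this] A_derivable[OF _ this]
  have "mweight (add_mset \<chi> \<Gamma>) + mweight \<Delta> < N"
    using assms(2) 9 weight_decreasing(3)[of "\<phi> \<^bold>\<rightarrow> \<psi>" \<chi>] by simp
  note B = A_vars[OF assms(3) this] A_derivable[OF assms(3) this]
  have "add_mset ((\<phi> \<^bold>\<rightarrow> \<psi>) \<^bold>\<rightarrow> \<chi>) (add_mset ?a (add_mset ?b \<Gamma>)) \<turnstile> \<Delta>"
    using weakening1[OF A(2), of ?b] weakening1[OF B(2), of ?a] assms(3)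
    by (intro G4WK.ImpImpL) (simp_all add: add_mset_commute)
  then have "add_mset (?a \<^bold>\<and> ?b) (add_mset ((\<phi> \<^bold>\<rightarrow> \<psi>) \<^bold>\<rightarrow> \<chi>) \<Gamma>) \<turnstile> \<Delta>"
    using assms(3) by (intro G4WK.AndL) (simp_all add: add_mset_commute)
  with assms(1) 9 A(1) B(1) show ?thesis
    by auto
next
  case (10 p' \<phi> \<chi> \<Gamma>' \<Delta>')
  let ?a = "A p (box_inv \<Gamma>) {#\<phi>#}" and ?b = "A p (add_mset \<chi> \<Gamma>) \<Delta>"
  have *: "mweight (box_inv \<Gamma>) + mweight {#\<phi>#} < N" "mweight (add_mset \<chi> \<Gamma>) + mweight \<Delta> < N"
    using assms(2) 10 weight_decreasing(3)[of "\<^bold>\<box> \<phi>" \<chi>] mweight_box_inv[of \<Gamma>] by simp_all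
  note A = A_vars[OF _ *(1)] A_derivable[OF _ *(1)]
    and B = A_vars[OF assms(3) *(2)] A_derivable[OF assms(3) *(2)]
  \<comment> \<open>Nothing is known about the shape of the chosen formula \<open>?b\<close>. If it
    happens to be a box, its body enters the modal premise, which is then weakened by
    \<open>unBox ?b\<close>.\<close>
  have "box_inv (add_mset (\<^bold>\<box> ?a) (add_mset ?b \<Gamma>)) \<turnstile> {#\<phi>#}"
    using A(2) weakening1[OF A(2), of "unBox ?b"] by (simp add: add_mset_commute)
  moreover have "add_mset \<chi> (add_mset (\<^bold>\<box> ?a) (add_mset ?b \<Gamma>)) \<turnstile> \<Delta>"
    using weakening1[OF B(2), of "\<^bold>\<box> ?a"] by (simp add: add_mset_commute)
  ultimately have "add_mset (\<^bold>\<box> \<phi> \<^bold>\<rightarrow> \<chi>) (add_mset (\<^bold>\<box> ?a) (add_mset ?b \<Gamma>)) \<turnstile> \<Delta>"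
    using assms(3) by (intro G4WK.BoxImpL)
  then have "add_mset (\<^bold>\<box> ?a \<^bold>\<and> ?b) (add_mset (\<^bold>\<box> \<phi> \<^bold>\<rightarrow> \<chi>) \<Gamma>) \<turnstile> \<Delta>"
    using assms(3) by (intro G4WK.AndL) (simp_all add: add_mset_commute)
  with assms(1) 10 A(1) B(1) mvars_box_inv[of \<Gamma>] show ?thesis
    by auto
next
  case (11 p' \<phi> \<chi> \<Gamma>' \<Delta>')
  let ?b = "A p (add_mset \<chi> \<Gamma>) \<Delta>"
  have "mweight (add_mset \<chi> \<Gamma>) + mweight \<Delta> < N"
    using assms(2) 11 weight_decreasing(3)[of "\<^bold>\<diamond> \<phi>" \<chi>] by simp
  note B = A_vars[OF assms(3) this] A_derivable[OF assms(3) this]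
  consider "c = \<^bold>\<diamond> (A p (box_inv \<Gamma>) {#\<phi>#}) \<^bold>\<and> ?b"
    | \<gamma> where "\<^bold>\<diamond> \<gamma> \<in># \<Gamma>" "c = \<^bold>\<box> (A p (add_mset \<gamma> (box_inv \<Gamma>)) {#\<phi>#}) \<^bold>\<and> ?b"
    using assms(1) 11 by auto
  then show ?thesis
  proof cases
    case 1
    let ?a = "A p (box_inv \<Gamma>) {#\<phi>#}"
    have "mweight (box_inv \<Gamma>) + mweight {#\<phi>#} < N"
      using assms(2) 11 weight_decreasing(3)[of "\<^bold>\<diamond> \<phi>" \<chi>] mweight_box_inv[of \<Gamma>] by simp
    note A = A_vars[OF _ this] A_derivable[OF _ this]
    have "add_mset (\<^bold>\<diamond> ?a) (add_mset \<chi> (add_mset ?b \<Gamma>)) \<turnstile> \<Delta>"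
      using weakening1[OF B(2), of "\<^bold>\<diamond> ?a"] by (simp add: add_mset_commute)
    moreover have "add_mset ?a (box_inv (add_mset ?b \<Gamma>)) \<turnstile> {#\<phi>#}"
      using A(2) weakening1[OF A(2), of "unBox ?b"] by (simp add: add_mset_commute)
    ultimately have
      "add_mset (\<^bold>\<diamond> ?a) (add_mset (\<^bold>\<diamond> \<phi> \<^bold>\<rightarrow> \<chi>) (add_mset ?b \<Gamma>)) \<turnstile> \<Delta>"
      using assms(3) by (intro G4WK.DiaImpL)
    then have "add_mset (\<^bold>\<diamond> ?a \<^bold>\<and> ?b) (add_mset (\<^bold>\<diamond> \<phi> \<^bold>\<rightarrow> \<chi>) \<Gamma>) \<turnstile> \<Delta>"
      using assms(3) by (intro G4WK.AndL) (simp_all add: add_mset_commute)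
    with 1 11 A(1) B(1) mvars_box_inv[of \<Gamma>] show ?thesis
      by auto
  next
    case (2 \<gamma>)
    let ?a = "A p (add_mset \<gamma> (box_inv \<Gamma>)) {#\<phi>#}"
    have \<alpha>: "\<alpha> = \<^bold>\<diamond> \<phi> \<^bold>\<rightarrow> \<chi>"
      using 11 by simp
    obtain \<Gamma>'' where \<Gamma>'': "\<Gamma> = add_mset (\<^bold>\<diamond> \<gamma>) \<Gamma>''"
      using 2 by (auto dest: multi_member_split)
    have "mweight (add_mset \<gamma> (box_inv \<Gamma>)) + mweight {#\<phi>#} < N"
      using assms(2) \<alpha> \<Gamma>'' weight_decreasing(3)[of "\<^bold>\<diamond> \<phi>" \<chi>] mweight_box_inv[of \<Gamma>''] by simp
    note A = A_vars[OF _ this] A_derivable[OF _ this]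
    let ?\<Sigma> = "add_mset (\<^bold>\<box> ?a) (add_mset ?b \<Gamma>'')"
    have "add_mset (\<^bold>\<diamond> \<gamma>) (add_mset \<chi> ?\<Sigma>) \<turnstile> \<Delta>"
      using weakening1[OF B(2), of "\<^bold>\<box> ?a"] \<Gamma>'' by (simp add: add_mset_commute)
    moreover have "add_mset \<gamma> (box_inv ?\<Sigma>) \<turnstile> {#\<phi>#}"
      using A(2) weakening1[OF A(2), of "unBox ?b"] \<Gamma>'' by (simp add: add_mset_commute)
    ultimately have "add_mset (\<^bold>\<diamond> \<gamma>) (add_mset (\<^bold>\<diamond> \<phi> \<^bold>\<rightarrow> \<chi>) ?\<Sigma>) \<turnstile> \<Delta>"
      using assms(3) by (intro G4WK.DiaImpL)
    moreover have "add_mset (\<^bold>\<diamond> \<gamma>) (add_mset (\<^bold>\<diamond> \<phi> \<^bold>\<rightarrow> \<chi>) ?\<Sigma>) =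
        add_mset (\<^bold>\<box> ?a) (add_mset ?b (add_mset (\<^bold>\<diamond> \<phi> \<^bold>\<rightarrow> \<chi>) \<Gamma>))"
      by (simp add: \<Gamma>'' add_mset_commute)
    ultimately have "add_mset (\<^bold>\<box> ?a \<^bold>\<and> ?b) (add_mset (\<^bold>\<diamond> \<phi> \<^bold>\<rightarrow> \<chi>) \<Gamma>) \<turnstile> \<Delta>"
      using assms(3) by (auto intro: G4WK.AndL)
    moreover have vars: "vars ?a \<subseteq> vars \<gamma> \<union> mvars \<Gamma>'' \<union> vars \<phi> - {p}"
      using A(1) \<Gamma>'' mvars_box_inv[of \<Gamma>''] by fastforce
    ultimately show ?thesis
      using 2 11 B(1) \<Gamma>''
      by auto
  qed
next
  case (12 p' \<phi> \<Gamma>' \<Delta>')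
  with assms show ?thesis by simp
next
  case (13 p' \<phi> \<Gamma>' \<Delta>')
  let ?\<Gamma> = "add_mset \<phi> (box_inv \<Gamma>)"
  let ?a = "A p ?\<Gamma> (dia_inv \<Delta>)"
  have "mweight ?\<Gamma> + mweight (dia_inv \<Delta>) < N"
    using assms(2) 13 mweight_box_inv[of \<Gamma>] weight_decreasing(8)[of \<phi>] mweight_dia_inv[of \<Delta>]
    by (simp del: weight.simps)
  moreover have "size (dia_inv \<Delta>) \<le> 1"
    using assms(3) size_dia_inv[of \<Delta>] by simp
  ultimately have A: "vars ?a \<subseteq> mvars ?\<Gamma> \<union> mvars (dia_inv \<Delta>) - {p}" "add_mset ?a ?\<Gamma> \<turnstile> dia_inv \<Delta>"
    using A_vars A_derivable by blast+
  have "add_mset (\<^bold>\<diamond> \<phi>) (add_mset (\<^bold>\<box> ?a) \<Gamma>) \<turnstile> \<Delta>"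
    using A(2) assms(3) by (intro G4WK.DiaL) (simp_all add: add_mset_commute)
  with assms(1) 13 A(1) mvars_box_inv[of \<Gamma>] mvars_dia_inv[of \<Delta>] show ?thesis
    by (auto simp: add_mset_commute)
qed

lemma A_right_sound:
  assumes "c \<in># A_right p \<Gamma> \<alpha>" "mweight \<Gamma> + weight \<alpha> \<le> N"
  shows "vars c \<subseteq> mvars \<Gamma> \<union> vars \<alpha> - {p} \<and> (add_mset c \<Gamma> \<turnstile> {#\<alpha>#})"
proof (cases \<alpha>)
  case (Var q)
  with assms show ?thesis
    by (auto split: if_splits intro!: G4WK.IdP)
next
  case (And \<phi> \<psi>)
  let ?a = "A p \<Gamma> {#\<phi>#}" and ?b = "A p \<Gamma> {#\<psi>#}"
  have *: "mweight \<Gamma> + mweight {#\<phi>#} < N" "mweight \<Gamma> + mweight {#\<psi>#} < N"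
    using assms(2) And weight_decreasing(1)[of \<phi> \<psi>] by simp_all
  have "add_mset ?a (add_mset ?b \<Gamma>) \<turnstile> {#\<phi> \<^bold>\<and> \<psi>#}"
    using weakening1[OF A_derivable[OF _ *(1)], of ?b]
      weakening1[OF A_derivable[OF _ *(2)], of ?a]
    by (intro G4WK.AndR) (simp_all add: add_mset_commute)
  with assms(1) And A_vars[OF _ *(1)] A_vars[OF _ *(2)] show ?thesis
    by (auto intro!: G4WK.AndL)
next
  case (Or \<phi> \<psi>)
  have *: "mweight \<Gamma> + mweight {#\<phi>#} < N" "mweight \<Gamma> + mweight {#\<psi>#} < N"
    using assms(2) Or weight_decreasing(2)[of \<phi> \<psi>] by simp_all
  with assms(1) Or A_vars[OF _ *(1)] A_vars[OF _ *(2)] A_derivable[OF _ *(1)] A_derivable[OF _ *(2)]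
  show ?thesis
    by (auto intro: G4WK.OrR1 G4WK.OrR2)
next
  case (Imp \<phi> \<psi>)
  have *: "mweight (add_mset \<phi> \<Gamma>) + mweight {#\<psi>#} < N"
    using assms(2) Imp weight_decreasing(3)[of \<phi> \<psi>] by simp
  with assms(1) Imp A_vars[OF _ *] A_derivable[OF _ *] show ?thesis
    by (auto simp: add_mset_commute intro!: G4WK.ImpR)
next
  case (Box \<phi>)
  have *: "mweight (box_inv \<Gamma>) + mweight {#\<phi>#} < N"
    using assms(2) Box mweight_box_inv[of \<Gamma>] weight_decreasing(7,8)[of \<phi>] by (simp del: weight.simps)
  with assms(1) Box A_vars[OF _ *] A_derivable[OF _ *] mvars_box_inv[of \<Gamma>] show ?thesis
    by (auto intro!: G4WK.BoxR)
qed (use assms in auto)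

lemma E_context_sound:
  assumes "c \<in># E_context p \<Gamma>" "mweight \<Gamma> \<le> N"
  shows "vars c \<subseteq> mvars \<Gamma> - {p} \<and> (\<Gamma> \<turnstile> {#c#})"
  using assms(1)
proof (cases rule: in_E_contextE)
  case (1 \<phi> \<Gamma>')
  with E_conjuncts_sound[of c \<phi> \<Gamma>'] assms(2) show ?thesis by simp
qed

lemma A_disjuncts_sound:
  assumes "c \<in># A_disjuncts p \<Gamma> \<Delta>" "mweight \<Gamma> + mweight \<Delta> \<le> N" "size \<Delta> \<le> 1"
  shows "vars c \<subseteq> mvars \<Gamma> \<union> mvars \<Delta> - {p} \<and> (add_mset c \<Gamma> \<turnstile> \<Delta>)"
  using assms(1)
proof (cases rule: in_A_disjunctsE)
  case (left \<phi> \<Gamma>')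
  with A_left_sound[of c \<phi> \<Gamma>' \<Delta>] assms(2,3) show ?thesis by simp
next
  case (right \<phi>)
  then have "\<Delta> = {#\<phi>#}"
    using assms(3) by (auto dest!: multi_member_split)
  with right A_right_sound[of c \<Gamma> \<phi>] assms(2) show ?thesis by simp
next
  case dia
  have size: "size (dia_inv \<Delta>) \<le> 1"
    using assms(3) size_dia_inv[of \<Delta>] by simp
  \<comment> \<open>Strictness comes from the guard on the last summand of
    \<open>A_disjuncts\<close>.\<close>
  have "mweight (box_inv \<Gamma>) + mweight (dia_inv \<Delta>) < N"
    using dia(1) assms(2) by simp
  from A_vars[OF size this] A_derivable[OF size this] dia(2) assms(3)
    mvars_box_inv[of \<Gamma>] mvars_dia_inv[of \<Delta>]
  show ?thesis
    by (auto intro!: G4WK.DiaL)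
qed

end

section \<open>Uniformity\<close>

text \<open>Any boxed member of \<Gamma> will do: its clause puts the body back beside the other
  unboxed formulas, so the conjunct is the box of \<open>E p (box_inv \<Gamma>)\<close> whichever
  member is taken.\<close>

lemma box_inv_E_context:
  assumes "box_inv \<Gamma> \<noteq> {#}"
  shows "E p (box_inv \<Gamma>) \<in># box_inv (E_context p \<Gamma>)"
proof -
  obtain \<phi> where "\<^bold>\<box> \<phi> \<in># \<Gamma>"
    using assms by (meson in_box_inv_iff multiset_nonemptyE)
  then obtain \<Gamma>' where "\<Gamma> = add_mset (\<^bold>\<box> \<phi>) \<Gamma>'"
    by (auto dest: multi_member_split)
  then show ?thesis
    using in_E_context[of "\<^bold>\<box> (E p (box_inv \<Gamma>))" p "\<^bold>\<box> \<phi>" \<Gamma>'] by simp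
qed

text \<open>The two alternatives for \<open>T\<close> are the two halves of uniformity; they are proved simultaneously, as
  all rules acting on \<open>\<Pi>\<close> treat them alike. Working with the unfolded multiset \<open>E_context p \<Gamma>\<close> instead
  of its conjunction makes contraction unnecessary.\<close>

lemma (in interpolants_below) uniformity:
  assumes "\<Sigma> \<turnstile> \<Theta>" "\<Sigma> = \<Pi> + \<Gamma>" "p \<notin> mvars \<Pi>"
    and "p \<notin> mvars \<Theta> \<and> T = \<Theta> \<or> \<Theta> = \<Delta> \<and> T = {#BigOr (A_disjuncts p \<Gamma> \<Delta>)#}"
    and N: "mweight \<Gamma> + mweight \<Delta> = N" and \<Delta>: "size \<Delta> \<le> 1"
  shows "\<Pi> + E_context p \<Gamma> \<turnstile> T"
proof -
  define C where "C = E_context p \<Gamma>"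
  define D where "D = A_disjuncts p \<Gamma> \<Delta>"
  \<comment> \<open>\<Theta> and \<open>T\<close> vary while \<Delta> stays fixed: a premise whose
    succedent is a new \<open>p\<close>-free formula falls under the first alternative
    (\<open>okI\<close>).\<close>
  define ok where "ok \<Theta> T \<longleftrightarrow> p \<notin> mvars \<Theta> \<and> T = \<Theta> \<or> \<Theta> = \<Delta> \<and> T = {#BigOr D#}" for \<Theta> T
  have ok_size: "size T \<le> 1" if "ok \<Theta> T" "size \<Theta> \<le> 1" for \<Theta> T
    using that by (auto simp: ok_def)
  have okI: "ok \<Theta> \<Theta>" if "p \<notin> mvars \<Theta>" for \<Theta>
    using that by (simp add: ok_def)
  have useC: "\<Pi> + C \<turnstile> T" if "c \<in># C" "add_mset c \<Pi> \<turnstile> T" for c \<Pi> T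
  proof -
    from that(1) obtain C' where "C = add_mset c C'"
      by (auto dest: multi_member_split)
    with weakening[OF that(2), of C'] show ?thesis by simp
  qed
  have useD: "\<Pi> + C \<turnstile> {#BigOr D#}" if "c \<in># D" "\<Pi> \<turnstile> {#c#}" for c \<Pi>
    using that by (intro weakening BigOrR)
  \<comment> \<open>Handles modal premises with \<open>p\<close>-free succedent through an
    interpolant of smaller weight. If \<open>box_inv \<Gamma>\<close> is empty, no such interpolant
    need exist below \<open>N\<close>, but weakening suffices.\<close>
  have box_premise: "\<Pi> + box_inv C \<turnstile> \<Theta>"
    if "p \<notin> mvars \<Pi>" "p \<notin> mvars \<Theta>" "\<Pi> + box_inv \<Gamma> \<turnstile> \<Theta>" for \<Pi> \<Theta>
  proof (cases "box_inv \<Gamma> = {#}")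
    case True
    with that weakening[of \<Pi> \<Theta> "box_inv C"] show ?thesis by simp
  next
    case False
    then have "mweight (box_inv \<Gamma>) < N"
      using mweight_box_inv_less[of \<Gamma>] N by simp
    from E_uniform[OF this that] have "add_mset (E p (box_inv \<Gamma>)) \<Pi> \<turnstile> \<Theta>" .
    moreover obtain C' where "box_inv C = add_mset (E p (box_inv \<Gamma>)) C'"
      using box_inv_E_context[OF False, of p] by (auto simp: C_def dest: multi_member_split)
    ultimately show ?thesis
      using weakening[of "add_mset (E p (box_inv \<Gamma>)) \<Pi>" \<Theta> C'] by simp
  qed
  \<comment> \<open>For steps on \<Gamma> with one premise to interpolate, where the interpolants of
    that premise are themselves the conjunct and the disjunct.\<close>
  have unary: "\<Pi> + C \<turnstile> T"
    if prems: "ok \<Theta> T" "p \<notin> mvars \<Pi>" "\<Pi> + \<Gamma>' \<turnstile> \<Theta>" "mweight \<Gamma>' < mweight \<Gamma>"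
      "E p \<Gamma>' \<in># C" "A p \<Gamma>' \<Delta> \<in># D" for \<Theta> T \<Pi> \<Gamma>'
  proof -
    have less: "mweight \<Gamma>' < N" "mweight \<Gamma>' + mweight \<Delta> < N"
      using prems(4) N by simp_all
    consider "p \<notin> mvars \<Theta>" "T = \<Theta>" | "\<Theta> = \<Delta>" "T = {#BigOr D#}"
      using prems(1) by (auto simp: ok_def)
    then show ?thesis
    proof cases
      case 1
      with E_uniform[OF less(1) prems(2) _ prems(3)] prems(5) show ?thesis
        by (auto intro: useC)
    next
      case 2
      with A_uniform[OF \<Delta> less(2) prems(2)] prems(3,6) show ?thesis
        by (auto intro: useD)
    qed
  qed
  \<comment> \<open>For implications in \<Gamma>: \<alpha> records what \<open>\<Pi>\<close>
    contributes to proving the antecedent, and \<Gamma>' is the antecedent part of the premise with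
    the consequent.\<close>
  have guarded: "\<Pi> + C \<turnstile> T"
    if prems: "ok \<Theta> T" "p \<notin> mvars \<Pi>" "\<Pi> \<turnstile> {#\<alpha>#}" "\<Pi> + \<Gamma>' \<turnstile> \<Theta>" "mweight \<Gamma>' < mweight \<Gamma>"
      "(\<alpha> \<^bold>\<rightarrow> E p \<Gamma>') \<in># C" "(\<alpha> \<^bold>\<and> A p \<Gamma>' \<Delta>) \<in># D" for \<Theta> T \<Pi> \<Gamma>' \<alpha>
  proof -
    have less: "mweight \<Gamma>' < N" "mweight \<Gamma>' + mweight \<Delta> < N"
      using prems(5) N by simp_all
    consider "p \<notin> mvars \<Theta>" "T = \<Theta>" | "\<Theta> = \<Delta>" "T = {#BigOr D#}"
      using prems(1) by (auto simp: ok_def)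
    then show ?thesis
    proof cases
      case 1
      then have "add_mset (E p \<Gamma>') \<Pi> \<turnstile> T"
        using E_uniform[OF less(1) prems(2) _ prems(4)] by simp
      then show ?thesis
        by (rule useC[OF prems(6) ImpL[OF prems(3)]])
    next
      case 2
      with A_uniform[OF \<Delta> less(2) prems(2)] prems(3,4,7) show ?thesis
        by (auto intro: useD G4WK.AndR)
    qed
  qed
  have in_C: "c \<in># C" if "\<Gamma> = add_mset \<phi> \<Gamma>'" "c \<in># E_conjuncts p \<phi> \<Gamma>'" for c \<phi> \<Gamma>'
    using that in_E_context by (simp add: C_def)
  have in_D: "c \<in># D" if "\<Gamma> = add_mset \<phi> \<Gamma>'" "c \<in># A_left p \<phi> \<Gamma>' \<Delta>" for c \<phi> \<Gamma>'
    using that in_A_disjuncts_left by (simp add: D_def)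
  have in_D': "c \<in># D" if "\<Delta> = {#\<phi>#}" "c \<in># A_right p \<Gamma> \<phi>" for c \<phi>
    using that in_A_disjuncts_right by (simp add: D_def)
  \<comment> \<open>The inner induction keeps \<Gamma> and \<Delta>, hence \<open>C\<close> and
    \<open>D\<close>, fixed. A premise in which \<Gamma> or the goal \<Delta> has been changed is
    passed to \<open>E_uniform\<close> or \<open>A_uniform\<close> at smaller weight.\<close>
  have "\<Pi> + C \<turnstile> T" if "\<Sigma> \<turnstile> \<Theta>" "\<Sigma> = \<Pi> + \<Gamma>" "p \<notin> mvars \<Pi>" "ok \<Theta> T" for \<Pi> T
    using that
  proof (induction arbitrary: \<Pi> T rule: G4WK.induct)
    case (BotL \<Theta> \<Sigma>)
    note size = ok_size[OF BotL.prems(3) BotL.hyps]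
    from BotL.prems(1) show ?case
    proof (cases rule: add_mset_eq_unionE)
      case (left \<Pi>')
      with size show ?thesis by (auto intro: G4WK.BotL)
    next
      case (right \<Gamma>')
      with size show ?thesis
        by (intro useC[of "\<^bold>\<bottom>"] in_C[of "\<^bold>\<bottom>"]) (auto intro: G4WK.BotL)
    qed
  next
    case (IdP q \<Sigma>)
    show ?case
    proof (cases "q = p")
      case True
      \<comment> \<open>The succedent contains \<open>p\<close>, which rules out the first
        alternative, and the left occurrence of \<open>Var p\<close> cannot lie in the
        \<open>p\<close>-free \<open>\<Pi>\<close>.\<close>
      with IdP.prems have "\<Delta> = {#Var p#}" "T = {#BigOr D#}"
        by (auto simp: ok_def)
      moreover from IdP.prems(1) obtain \<Gamma>' where "\<Gamma> = add_mset (Var p) \<Gamma>'"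
        using True IdP.prems(2) by (cases rule: add_mset_eq_unionE) auto
      ultimately show ?thesis
        using in_D[of "Var p" \<Gamma>' Top] by (auto intro: useD Top_derivable)
    next
      case False
      from IdP.prems(1) have "\<Pi> + C \<turnstile> {#Var q#}"
      proof (cases rule: add_mset_eq_unionE)
        case (left \<Pi>')
        then show ?thesis by (auto intro: G4WK.IdP)
      next
        case (right \<Gamma>')
        with False show ?thesis
          by (intro useC[of "Var q"] in_C[of "Var q"]) (auto intro: G4WK.IdP)
      qed
      moreover have "Var q \<in># D" if "\<Delta> = {#Var q#}"
        using in_D'[OF that] False by simp
      ultimately show ?thesis
        using IdP.prems(3) by (auto simp: ok_def intro: BigOrR)
    qed
  next
    case (AndL \<Theta> \<phi> \<psi> \<Sigma>)
    from AndL.prems(1) show ?case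
    proof (cases rule: add_mset_eq_unionE)
      case (left \<Pi>')
      with AndL.IH[of "add_mset \<phi> (add_mset \<psi> \<Pi>')" T] AndL.prems ok_size[OF AndL.prems(3) AndL.hyps(1)]
      show ?thesis by (auto intro!: G4WK.AndL)
    next
      case (right \<Gamma>')
      with AndL.hyps(2) AndL.prems weight_decreasing(1)[of \<phi> \<psi>] show ?thesis
        by (intro unary[of \<Theta> T \<Pi> "add_mset \<phi> (add_mset \<psi> \<Gamma>')"] in_C[OF right(1)] in_D[OF right(1)])
          (simp_all del: weight.simps)
    qed
  next
    case (AndR \<Sigma> \<phi> \<psi>)
    from AndR.prems(3) consider
        "p \<notin> vars \<phi>" "p \<notin> vars \<psi>" "T = {#\<phi> \<^bold>\<and> \<psi>#}"
      | "\<Delta> = {#\<phi> \<^bold>\<and> \<psi>#}" "T = {#BigOr D#}"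
      by (auto simp: ok_def)
    then show ?case
    proof cases
      case 1
      with AndR.IH(1)[of \<Pi> "{#\<phi>#}"] AndR.IH(2)[of \<Pi> "{#\<psi>#}"] AndR.prems
        okI[of "{#\<phi>#}"] okI[of "{#\<psi>#}"]
      show ?thesis by (auto intro: G4WK.AndR)
    next
      case 2
      then have "mweight \<Gamma> + mweight {#\<phi>#} < N" "mweight \<Gamma> + mweight {#\<psi>#} < N"
        using N weight_decreasing(1)[of \<phi> \<psi>] by simp_all
      from A_uniform[OF _ this(1), of \<Pi>] A_uniform[OF _ this(2), of \<Pi>] AndR.hyps AndR.prems
      have "\<Pi> \<turnstile> {#A p \<Gamma> {#\<phi>#} \<^bold>\<and> A p \<Gamma> {#\<psi>#}#}"
        by (auto intro: G4WK.AndR)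
      with in_D'[OF 2(1)] 2(2) show ?thesis
        by (auto intro: useD)
    qed
  next
    case (OrL \<Theta> \<phi> \<Sigma> \<psi>)
    from OrL.prems(1) show ?case
    proof (cases rule: add_mset_eq_unionE)
      case (left \<Pi>')
      with OrL.IH(1)[of "add_mset \<phi> \<Pi>'" T] OrL.IH(2)[of "add_mset \<psi> \<Pi>'" T] OrL.prems
        ok_size[OF OrL.prems(3) OrL.hyps(1)]
      show ?thesis by (auto intro!: G4WK.OrL)
    next
      case (right \<Gamma>')
      let ?\<phi> = "add_mset \<phi> \<Gamma>'" and ?\<psi> = "add_mset \<psi> \<Gamma>'"
      have less: "mweight ?\<phi> < N" "mweight ?\<psi> < N"
        "mweight ?\<phi> + mweight \<Delta> < N" "mweight ?\<psi> + mweight \<Delta> < N"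
        using N right(1) weight_decreasing(2)[of \<phi> \<psi>] by simp_all
      have prems: "\<Pi> + ?\<phi> \<turnstile> \<Theta>" "\<Pi> + ?\<psi> \<turnstile> \<Theta>"
        using OrL.hyps right(2) by simp_all
      from OrL.prems(3) consider "p \<notin> mvars \<Theta>" "T = \<Theta>" | "\<Theta> = \<Delta>" "T = {#BigOr D#}"
        by (auto simp: ok_def)
      then show ?thesis
      proof cases
        case 1
        from E_uniform[OF less(1) OrL.prems(2) 1(1) prems(1)] E_uniform[OF less(2) OrL.prems(2) 1(1) prems(2)]
        have "add_mset (E p ?\<phi> \<^bold>\<or> E p ?\<psi>) \<Pi> \<turnstile> T"
          using OrL.hyps(1) 1(2) by (simp add: G4WK.OrL)
        then show ?thesis
          by (intro useC in_C[OF right(1)]) simp_all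
      next
        case 2
        with A_uniform[OF \<Delta> less(3) OrL.prems(2)] A_uniform[OF \<Delta> less(4) OrL.prems(2)] prems
        have "\<Pi> \<turnstile> {#A p ?\<phi> \<Delta> \<^bold>\<and> A p ?\<psi> \<Delta>#}"
          by (auto intro: G4WK.AndR)
        then show ?thesis
          using in_D[OF right(1)] 2(2) by (auto intro: useD)
      qed
    qed
  next
    case (OrR1 \<Sigma> \<phi> \<psi>)
    from OrR1.prems(3) consider
        "p \<notin> vars \<phi>" "T = {#\<phi> \<^bold>\<or> \<psi>#}"
      | "\<Delta> = {#\<phi> \<^bold>\<or> \<psi>#}" "T = {#BigOr D#}"
      by (auto simp: ok_def)
    then show ?case
    proof cases
      case 1
      with OrR1.IH[of \<Pi> "{#\<phi>#}"] OrR1.prems okI[of "{#\<phi>#}"] show ?thesis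
        by (auto intro: G4WK.OrR1)
    next
      case 2
      then have "mweight \<Gamma> + mweight {#\<phi>#} < N"
        using N weight_decreasing(2)[of \<phi> \<psi>] by simp
      from A_uniform[OF _ this, of \<Pi>] OrR1.hyps OrR1.prems have "\<Pi> \<turnstile> {#A p \<Gamma> {#\<phi>#}#}"
        by simp
      with in_D'[OF 2(1)] 2(2) show ?thesis
        by (auto intro: useD)
    qed
  next
    case (OrR2 \<Sigma> \<psi> \<phi>)
    from OrR2.prems(3) consider
        "p \<notin> vars \<psi>" "T = {#\<phi> \<^bold>\<or> \<psi>#}"
      | "\<Delta> = {#\<phi> \<^bold>\<or> \<psi>#}" "T = {#BigOr D#}"
      by (auto simp: ok_def)
    then show ?case
    proof cases
      case 1
      with OrR2.IH[of \<Pi> "{#\<psi>#}"] OrR2.prems okI[of "{#\<psi>#}"] show ?thesis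
        by (auto intro: G4WK.OrR2)
    next
      case 2
      then have "mweight \<Gamma> + mweight {#\<psi>#} < N"
        using N weight_decreasing(2)[of \<phi> \<psi>] by simp
      from A_uniform[OF _ this, of \<Pi>] OrR2.hyps OrR2.prems have "\<Pi> \<turnstile> {#A p \<Gamma> {#\<psi>#}#}"
        by simp
      with in_D'[OF 2(1)] 2(2) show ?thesis
        by (auto intro: useD)
    qed
  next
    case (ImpR \<phi> \<Sigma> \<psi>)
    from ImpR.prems(3) consider
        "p \<notin> vars \<phi>" "p \<notin> vars \<psi>" "T = {#\<phi> \<^bold>\<rightarrow> \<psi>#}"
      | "\<Delta> = {#\<phi> \<^bold>\<rightarrow> \<psi>#}" "T = {#BigOr D#}"
      by (auto simp: ok_def)
    then show ?case
    proof cases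
      case 1
      with ImpR.IH[of "add_mset \<phi> \<Pi>" "{#\<psi>#}"] ImpR.prems okI[of "{#\<psi>#}"] show ?thesis
        by (auto intro: G4WK.ImpR)
    next
      case 2
      then have "mweight (add_mset \<phi> \<Gamma>) + mweight {#\<psi>#} < N"
        using N weight_decreasing(3)[of \<phi> \<psi>] by simp
      from A_uniform[OF _ this, of \<Pi>] ImpR.hyps ImpR.prems
      have "\<Pi> \<turnstile> {#A p (add_mset \<phi> \<Gamma>) {#\<psi>#}#}"
        by simp
      with in_D'[OF 2(1)] 2(2) show ?thesis
        by (auto intro: useD)
    qed
  next
    case (AndImpL \<Theta> \<phi> \<psi> \<chi> \<Sigma>)
    from AndImpL.prems(1) show ?case
    proof (cases rule: add_mset_eq_unionE)
      case (left \<Pi>')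
      with AndImpL.IH[of "add_mset (\<phi> \<^bold>\<rightarrow> (\<psi> \<^bold>\<rightarrow> \<chi>)) \<Pi>'" T] AndImpL.prems
        ok_size[OF AndImpL.prems(3) AndImpL.hyps(1)]
      show ?thesis by (auto intro!: G4WK.AndImpL)
    next
      case (right \<Gamma>')
      with AndImpL.hyps(2) AndImpL.prems weight_decreasing(4)[of \<phi> \<psi> \<chi>] show ?thesis
        by (intro unary[of \<Theta> T \<Pi> "add_mset (\<phi> \<^bold>\<rightarrow> (\<psi> \<^bold>\<rightarrow> \<chi>)) \<Gamma>'"]
            in_C[OF right(1)] in_D[OF right(1)]) (simp_all del: weight.simps)
    qed
  next
    case (OrImpL \<Theta> \<phi> \<chi> \<psi> \<Sigma>)
    from OrImpL.prems(1) show ?case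
    proof (cases rule: add_mset_eq_unionE)
      case (left \<Pi>')
      with OrImpL.IH[of "add_mset (\<phi> \<^bold>\<rightarrow> \<chi>) (add_mset (\<psi> \<^bold>\<rightarrow> \<chi>) \<Pi>')" T] OrImpL.prems
        ok_size[OF OrImpL.prems(3) OrImpL.hyps(1)]
      show ?thesis by (auto intro!: G4WK.OrImpL)
    next
      case (right \<Gamma>')
      with OrImpL.hyps(2) OrImpL.prems weight_decreasing(5)[of \<phi> \<chi> \<psi>] show ?thesis
        by (intro unary[of \<Theta> T \<Pi> "add_mset (\<phi> \<^bold>\<rightarrow> \<chi>) (add_mset (\<psi> \<^bold>\<rightarrow> \<chi>) \<Gamma>')"]
            in_C[OF right(1)] in_D[OF right(1)]) (simp_all del: weight.simps)
    qed
  next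
    case (VarImpL \<Theta> q \<phi> \<Sigma>)
    note size = ok_size[OF VarImpL.prems(3) VarImpL.hyps(1)]
    have less: "mweight (add_mset \<phi> \<Gamma>') < mweight \<Gamma>" if "\<Gamma> = add_mset (Var q \<^bold>\<rightarrow> \<phi>) \<Gamma>'" for \<Gamma>'
      using that weight_decreasing(3)[of "Var q" \<phi>] by simp
    from VarImpL.prems(1) show ?case
    proof (cases rule: add_mset_eq_unionE)
      case (left \<Pi>')
      from left(2) show ?thesis
      proof (cases rule: add_mset_eq_unionE)
        case l: (left \<Pi>'')
        with left VarImpL.IH[of "add_mset (Var q) (add_mset \<phi> \<Pi>'')" T] VarImpL.prems size
        show ?thesis by (auto intro!: G4WK.VarImpL)
      next
        case (right \<Gamma>')
        with left VarImpL.hyps(2) VarImpL.prems less[OF right(1)] show ?thesis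
          by (intro guarded[of \<Theta> T \<Pi> "Var q" "add_mset \<phi> \<Gamma>'"] in_C[OF right(1)] in_D[OF right(1)])
            (auto intro: G4WK.IdP simp: add_mset_commute)
      qed
    next
      case (right \<Gamma>')
      from right(2) show ?thesis
      proof (cases rule: add_mset_eq_unionE)
        case (left \<Pi>')
        \<comment> \<open>The implication is in \<open>\<Pi>\<close> and its variable in \<Gamma>.
          The rule keeps the variable, so \<Gamma> is unchanged and the induction hypothesis
          applies; \<open>C\<close> already contains \<open>Var q\<close>, so nothing is
          duplicated.\<close>
        have IH: "add_mset \<phi> \<Pi>' + C \<turnstile> T"
          using VarImpL.IH[of "add_mset \<phi> \<Pi>'" T] VarImpL.prems left right by simp
        show ?thesis
        proof (cases "q = p")
          case True
          with left VarImpL.prems(2) show ?thesis by simp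
        next
          case False
          then have "Var q \<in># C"
            by (intro in_C[OF right(1)]) simp
          then obtain C' where "C = add_mset (Var q) C'"
            by (auto dest: multi_member_split)
          with IH left size G4WK.VarImpL[of T q \<phi> "\<Pi>' + C'"] show ?thesis
            by (simp add: add_mset_commute)
        qed
      next
        case r: (right \<Gamma>'')
        then have \<Gamma>: "\<Gamma> = add_mset (Var q \<^bold>\<rightarrow> \<phi>) (add_mset (Var q) \<Gamma>'')"
          using right by (simp add: add_mset_commute)
        from VarImpL.hyps(2) VarImpL.prems r less[OF \<Gamma>] show ?thesis
          by (intro unary[of \<Theta> T \<Pi> "add_mset \<phi> (add_mset (Var q) \<Gamma>'')"] in_C[OF \<Gamma>] in_D[OF \<Gamma>])
            (auto simp: add_mset_commute)
      qed
    qed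
  next
    case (ImpImpL \<Theta> \<psi> \<chi> \<Sigma> \<phi>)
    from ImpImpL.prems(1) show ?case
    proof (cases rule: add_mset_eq_unionE)
      case (left \<Pi>')
      with ImpImpL.IH(1)[of "add_mset (\<psi> \<^bold>\<rightarrow> \<chi>) \<Pi>'" "{#\<phi> \<^bold>\<rightarrow> \<psi>#}"]
        ImpImpL.IH(2)[of "add_mset \<chi> \<Pi>'" T] ImpImpL.prems
        ok_size[OF ImpImpL.prems(3) ImpImpL.hyps(1)] okI[of "{#\<phi> \<^bold>\<rightarrow> \<psi>#}"]
      show ?thesis by (auto intro!: G4WK.ImpImpL)
    next
      case (right \<Gamma>')
      let ?\<Gamma> = "add_mset (\<psi> \<^bold>\<rightarrow> \<chi>) \<Gamma>'"
      have "mweight ?\<Gamma> + mweight {#\<phi> \<^bold>\<rightarrow> \<psi>#} < N"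
        using N right(1) weight_decreasing(6)[of \<phi> \<psi> \<chi>] by simp
      from A_uniform[OF _ this ImpImpL.prems(2)] ImpImpL.hyps(2) right(2)
      have "\<Pi> \<turnstile> {#A p ?\<Gamma> {#\<phi> \<^bold>\<rightarrow> \<psi>#}#}"
        by simp
      with ImpImpL.hyps(3) ImpImpL.prems right weight_decreasing(3)[of "\<phi> \<^bold>\<rightarrow> \<psi>" \<chi>] show ?thesis
        by (intro guarded[of \<Theta> T \<Pi> _ "add_mset \<chi> \<Gamma>'"] in_C[OF right(1)] in_D[OF right(1)])
          (simp_all del: weight.simps)
    qed
  next
    case (BoxR \<Sigma> \<phi>)
    have prem: "box_inv \<Pi> + box_inv \<Gamma> \<turnstile> {#\<phi>#}"
      using BoxR.hyps BoxR.prems(1) by simp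
    have \<Pi>: "p \<notin> mvars (box_inv \<Pi>)"
      using BoxR.prems(2) mvars_box_inv by blast
    from BoxR.prems(3) consider
        "p \<notin> vars \<phi>" "T = {#\<^bold>\<box> \<phi>#}"
      | "\<Delta> = {#\<^bold>\<box> \<phi>#}" "T = {#BigOr D#}"
      by (auto simp: ok_def)
    then show ?case
    proof cases
      case 1
      with box_premise[OF \<Pi> _ prem] show ?thesis
        by (auto intro: G4WK.BoxR)
    next
      case 2
      then have "mweight (box_inv \<Gamma>) + mweight {#\<phi>#} < N"
        using N weight_decreasing(7)[of \<phi>] mweight_box_inv[of \<Gamma>] by (simp del: weight.simps)
      from A_uniform[OF _ this \<Pi> prem] have "\<Pi> \<turnstile> {#\<^bold>\<box> (A p (box_inv \<Gamma>) {#\<phi>#})#}"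
        by (auto intro: G4WK.BoxR)
      with in_D'[OF 2(1)] 2(2) show ?thesis
        by (auto intro: useD)
    qed
  next
    case (BoxImpL \<Theta> \<Sigma> \<phi> \<psi>)
    note size = ok_size[OF BoxImpL.prems(3) BoxImpL.hyps(1)]
    have \<Pi>: "p \<notin> mvars (box_inv \<Pi>)"
      using BoxImpL.prems(2) mvars_box_inv by blast
    from BoxImpL.prems(1) show ?case
    proof (cases rule: add_mset_eq_unionE)
      case (left \<Pi>')
      have "box_inv (\<Pi>' + C) \<turnstile> {#\<phi>#}"
        using box_premise[of "box_inv \<Pi>'" "{#\<phi>#}"] BoxImpL.hyps(2) BoxImpL.prems(2) \<Pi> left by simp
      with left BoxImpL.IH(2)[of "add_mset \<psi> \<Pi>'" T] BoxImpL.prems size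
      show ?thesis by (auto intro!: G4WK.BoxImpL)
    next
      case (right \<Gamma>')
      have "mweight (box_inv \<Gamma>') + mweight {#\<phi>#} < N"
        using N right(1) weight_decreasing(3)[of "\<^bold>\<box> \<phi>" \<psi>] mweight_box_inv[of \<Gamma>'] by simp
      from A_uniform[OF _ this \<Pi>] BoxImpL.hyps(2) right(2)
      have "\<Pi> \<turnstile> {#\<^bold>\<box> (A p (box_inv \<Gamma>') {#\<phi>#})#}"
        by (auto intro: G4WK.BoxR)
      with BoxImpL.hyps(3) BoxImpL.prems right weight_decreasing(3)[of "\<^bold>\<box> \<phi>" \<psi>] show ?thesis
        by (intro guarded[of \<Theta> T \<Pi> _ "add_mset \<psi> \<Gamma>'"] in_C[OF right(1)] in_D[OF right(1)])
          (simp_all del: weight.simps)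
    qed
  next
    case (DiaImpL \<Theta> \<gamma> \<Sigma> \<phi> \<psi>)
    note size = ok_size[OF DiaImpL.prems(3) DiaImpL.hyps(1)]
    have \<Pi>: "p \<notin> mvars (box_inv \<Pi>)"
      using DiaImpL.prems(2) mvars_box_inv by blast
    have less: "mweight (add_mset \<psi> \<Gamma>') < mweight \<Gamma>"
      if "\<Gamma> = add_mset (\<^bold>\<diamond> \<phi> \<^bold>\<rightarrow> \<psi>) \<Gamma>'" for \<Gamma>'
      using that weight_decreasing(3)[of "\<^bold>\<diamond> \<phi>" \<psi>] by (simp del: weight.simps)
    from DiaImpL.prems(1) show ?case
    proof (cases rule: add_mset_eq_unionE)
      case (left \<Pi>')
      from left(2) show ?thesis
      proof (cases rule: add_mset_eq_unionE)
        case l: (left \<Pi>'')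
        have "add_mset \<gamma> (box_inv (\<Pi>'' + C)) \<turnstile> {#\<phi>#}"
          using box_premise[of "add_mset \<gamma> (box_inv \<Pi>'')" "{#\<phi>#}"] DiaImpL.hyps(2) DiaImpL.prems(2) \<Pi> left l
          by simp
        with left l DiaImpL.IH(2)[of "add_mset (\<^bold>\<diamond> \<gamma>) (add_mset \<psi> \<Pi>'')" T] DiaImpL.prems size
        show ?thesis by (auto intro!: G4WK.DiaImpL)
      next
        case (right \<Gamma>')
        let ?a = "A p (box_inv \<Gamma>') {#\<phi>#}"
        have "mweight (box_inv \<Gamma>') + mweight {#\<phi>#} < N"
          using N right(1) weight_decreasing(3)[of "\<^bold>\<diamond> \<phi>" \<psi>] mweight_box_inv[of \<Gamma>'] by simp
        from A_uniform[OF _ this, of "add_mset \<gamma> (box_inv \<Pi>')"] DiaImpL.hyps(2) DiaImpL.prems(2) \<Pi> left right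
        have "add_mset \<gamma> (box_inv \<Pi>') \<turnstile> {#?a#}"
          by simp
        \<comment> \<open>\<gamma> stays on the \<open>p\<close>-free side, so \<open>\<Pi>\<close>
          itself proves the diamond guard.\<close>
        then have "\<Pi> \<turnstile> {#\<^bold>\<diamond> ?a#}"
          using left(1) by (auto intro: G4WK.DiaL)
        with left DiaImpL.hyps(3) DiaImpL.prems right less[OF right(1)] show ?thesis
          by (intro guarded[of \<Theta> T \<Pi> "\<^bold>\<diamond> ?a" "add_mset \<psi> \<Gamma>'"] in_C[OF right(1)] in_D[OF right(1)])
            (auto simp: add_mset_commute)
      qed
    next
      case (right \<Gamma>')
      from right(2) show ?thesis
      proof (cases rule: add_mset_eq_unionE)
        case (left \<Pi>')
        let ?\<Gamma> = "add_mset \<gamma> (box_inv \<Gamma>')"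
        have "mweight ?\<Gamma> < N"
          using N right(1) weight_decreasing(8)[of \<gamma>] mweight_box_inv[of \<Gamma>'] by (simp del: weight.simps)
        from E_uniform[OF this, of "box_inv \<Pi>'" "{#\<phi>#}"] DiaImpL.hyps(2) DiaImpL.prems(2) \<Pi> left
        have e: "add_mset (E p ?\<Gamma>) (box_inv \<Pi>') \<turnstile> {#\<phi>#}"
          by simp
        have IH: "add_mset \<psi> \<Pi>' + C \<turnstile> T"
          using DiaImpL.IH(2)[of "add_mset \<psi> \<Pi>'" T] DiaImpL.prems left right by simp
        \<comment> \<open>The diamond of \<gamma> lies in \<Gamma> and the implication in
          \<open>\<Pi>\<close>. This conjunct replaces the missing partner: by \<open>e\<close> its
          body proves \<phi> together with \<open>box_inv \<Pi>'\<close>.\<close>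
        have "\<^bold>\<diamond> (E p ?\<Gamma>) \<in># C"
          by (intro in_C[OF right(1)]) simp
        then obtain C' where C': "C = add_mset (\<^bold>\<diamond> (E p ?\<Gamma>)) C'"
          by (auto dest: multi_member_split)
        have "add_mset (\<^bold>\<diamond> (E p ?\<Gamma>)) (add_mset (\<^bold>\<diamond> \<phi> \<^bold>\<rightarrow> \<psi>) (\<Pi>' + C')) \<turnstile> T"
          using size weakening[OF e, of "box_inv C'"] IH C'
          by (intro G4WK.DiaImpL) (simp_all add: add_mset_commute)
        with C' left show ?thesis
          by (simp add: add_mset_commute)
      next
        case r: (right \<Gamma>'')
        then have \<Gamma>: "\<Gamma> = add_mset (\<^bold>\<diamond> \<phi> \<^bold>\<rightarrow> \<psi>) (add_mset (\<^bold>\<diamond> \<gamma>) \<Gamma>'')"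
          using right by (simp add: add_mset_commute)
        let ?a = "A p (add_mset \<gamma> (box_inv \<Gamma>'')) {#\<phi>#}"
        have "mweight (add_mset \<gamma> (box_inv \<Gamma>'')) + mweight {#\<phi>#} < N"
          using N \<Gamma> weight_decreasing(3)[of "\<^bold>\<diamond> \<phi>" \<psi>] mweight_box_inv[of \<Gamma>''] by simp
        from A_uniform[OF _ this \<Pi>] DiaImpL.hyps(2) r
        have "\<Pi> \<turnstile> {#\<^bold>\<box> ?a#}"
          by (auto intro: G4WK.BoxR)
        with DiaImpL.hyps(3) DiaImpL.prems r less[OF \<Gamma>] show ?thesis
          by (intro guarded[of \<Theta> T \<Pi> "\<^bold>\<box> ?a" "add_mset \<psi> (add_mset (\<^bold>\<diamond> \<gamma>) \<Gamma>'')"] in_C[OF \<Gamma>] in_D[OF \<Gamma>])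
            (auto simp: add_mset_commute)
      qed
    qed
  next
    case (DiaL \<Theta> \<phi> \<Sigma>)
    note size = ok_size[OF DiaL.prems(3) DiaL.hyps(1)]
    have \<Pi>: "p \<notin> mvars (box_inv \<Pi>)"
      using DiaL.prems(2) mvars_box_inv by blast
    have size_dia: "size (dia_inv \<Delta>) \<le> 1"
      using \<Delta> size_dia_inv[of \<Delta>] by simp
    from DiaL.prems(1) show ?case
    proof (cases rule: add_mset_eq_unionE)
      case (left \<Pi>')
      have \<Pi>': "p \<notin> mvars (add_mset \<phi> (box_inv \<Pi>'))"
        using DiaL.prems(2) \<Pi> left by simp
      have prem: "add_mset \<phi> (box_inv \<Pi>') + box_inv \<Gamma> \<turnstile> dia_inv \<Theta>"
        using DiaL.hyps(2) left by simp
      \<comment> \<open>The first case also absorbs the second alternative of \<open>ok\<close> when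
        both \<open>box_inv \<Gamma>\<close> and \<open>dia_inv \<Delta>\<close> are empty: the
        premise then has an empty succedent, so \<open>weakening_right\<close> adapts it to any
        \<open>T\<close>. What remains satisfies the guard in \<open>A_disjuncts\<close>.\<close>
      consider "p \<notin> mvars (dia_inv \<Theta>)" "T = \<Theta> \<or> dia_inv \<Theta> = {#}"
        | "\<Theta> = \<Delta>" "T = {#BigOr D#}" "box_inv \<Gamma> \<noteq> {#} \<or> dia_inv \<Delta> \<noteq> {#}"
        using DiaL.prems(3) mvars_dia_inv[of \<Theta>]
        by (cases "dia_inv \<Theta> = {#}"; cases "box_inv \<Gamma> = {#}") (auto simp: ok_def)
      then show ?thesis
      proof cases
        case 1
        have "add_mset \<phi> (box_inv (\<Pi>' + C)) \<turnstile> dia_inv T"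
          using box_premise[OF \<Pi>' 1(1) prem] 1(2) size_dia_inv[of T] size
          by (auto intro: weakening_right)
        with size left show ?thesis
          by (auto intro: G4WK.DiaL)
      next
        case 2
        then have less: "mweight (box_inv \<Gamma>) + mweight (dia_inv \<Delta>) < mweight \<Gamma> + mweight \<Delta>"
          using mweight_box_inv[of \<Gamma>] mweight_dia_inv[of \<Delta>] mweight_box_inv_less[of \<Gamma>]
            mweight_dia_inv_less[of \<Delta>] by linarith
        then have in_D: "\<^bold>\<diamond> (A p (box_inv \<Gamma>) (dia_inv \<Delta>)) \<in># D"
          by (simp add: D_def A_disjuncts_def)
        have "add_mset \<phi> (box_inv \<Pi>') \<turnstile> {#A p (box_inv \<Gamma>) (dia_inv \<Delta>)#}"
          using A_uniform[OF size_dia _ \<Pi>'] less N prem 2(1) by simp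
        then have "\<Pi> \<turnstile> {#\<^bold>\<diamond> (A p (box_inv \<Gamma>) (dia_inv \<Delta>))#}"
          using left by (auto intro: G4WK.DiaL)
        with in_D 2(2) show ?thesis
          by (auto intro: useD)
      qed
    next
      case (right \<Gamma>')
      let ?\<Gamma> = "add_mset \<phi> (box_inv \<Gamma>')"
      have prem: "box_inv \<Pi> + ?\<Gamma> \<turnstile> dia_inv \<Theta>"
        using DiaL.hyps(2) right by simp
      have less: "mweight ?\<Gamma> < N" "mweight ?\<Gamma> + mweight (dia_inv \<Delta>) < N"
        using N right(1) weight_decreasing(8)[of \<phi>] mweight_box_inv[of \<Gamma>'] mweight_dia_inv[of \<Delta>]
        by (simp_all del: weight.simps)
      from DiaL.prems(3) consider "p \<notin> mvars \<Theta>" "T = \<Theta>" | "\<Theta> = \<Delta>" "T = {#BigOr D#}"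
        by (auto simp: ok_def)
      then show ?thesis
      proof cases
        case 1
        then have "add_mset (E p ?\<Gamma>) (box_inv \<Pi>) \<turnstile> dia_inv T"
          using E_uniform[OF less(1) \<Pi> _ prem] mvars_dia_inv[of \<Theta>] by auto
        then have "add_mset (\<^bold>\<diamond> (E p ?\<Gamma>)) \<Pi> \<turnstile> T"
          using size by (intro G4WK.DiaL)
        then show ?thesis
          by (intro useC in_C[OF right(1)]) simp_all
      next
        case 2
        then have "\<Pi> \<turnstile> {#\<^bold>\<box> (A p ?\<Gamma> (dia_inv \<Delta>))#}"
          using A_uniform[OF size_dia less(2) \<Pi>] prem by (auto intro: G4WK.BoxR)
        with in_D[OF right(1)] 2(2) show ?thesis
          by (auto intro: useD)
      qed
    qed
  qed
  from this[OF assms(1-3)] assms(4) show ?thesis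
    by (simp add: C_def D_def ok_def)
qed

section \<open>Existence of the interpolants\<close>

lemma (in interpolants_below) is_E_BigAnd:
  assumes "mweight \<Gamma> = N"
  shows "is_E p \<Gamma> (BigAnd (E_context p \<Gamma>))"
  unfolding is_E_def
proof (intro conjI allI impI)
  show "vars (BigAnd (E_context p \<Gamma>)) \<subseteq> mvars \<Gamma> - {p}"
    using E_context_sound[of _ \<Gamma>] assms by (fastforce simp: vars_BigAnd mvars_def[of "E_context p \<Gamma>"])
  show "\<Gamma> \<turnstile> {#BigAnd (E_context p \<Gamma>)#}"
    using E_context_sound[of _ \<Gamma>] assms by (auto intro: BigAndR)
  show "add_mset (BigAnd (E_context p \<Gamma>)) \<Pi> \<turnstile> \<Theta>"
    if "p \<notin> mvars \<Pi>" "p \<notin> mvars \<Theta>" "\<Pi> + \<Gamma> \<turnstile> \<Theta>" for \<Pi> \<Theta>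
    \<comment> \<open>Taking the empty multiset for \<Delta> makes \<open>N\<close> the weight of
      \<Gamma> alone. The \<open>p\<close>-free succedent \<Theta> enters through the first
      alternative, so its weight is unrestricted.\<close>
    using uniformity[OF that(3) refl that(1), of \<Theta> "{#}"] that(2) assms by (auto intro: BigAndL)
qed

lemma (in interpolants_below) is_A_Imp:
  assumes "mweight \<Gamma> + mweight \<Delta> = N" "size \<Delta> \<le> 1"
  shows "is_A p \<Gamma> \<Delta> (BigAnd (E_context p \<Gamma>) \<^bold>\<rightarrow> BigOr (A_disjuncts p \<Gamma> \<Delta>))" (is "is_A p \<Gamma> \<Delta> (?e \<^bold>\<rightarrow> ?a)")
  unfolding is_A_def
proof (intro conjI allI impI)
  note sound = E_context_sound[of _ \<Gamma>] A_disjuncts_sound[of _ \<Gamma> \<Delta>]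
  show "vars (?e \<^bold>\<rightarrow> ?a) \<subseteq> mvars \<Gamma> \<union> mvars \<Delta> - {p}"
    using sound assms
    by (fastforce simp: vars_BigAnd vars_BigOr mvars_def[of "E_context p \<Gamma>"] mvars_def[of "A_disjuncts p \<Gamma> \<Delta>"])
  \<comment> \<open>\<Gamma> proves every conjunct of \<open>?e\<close>, so only the disjuncts of
    \<open>?a\<close> remain to be refuted or used one by one on the left.\<close>
  show "add_mset (?e \<^bold>\<rightarrow> ?a) \<Gamma> \<turnstile> \<Delta>"
    using sound assms by (intro ImpL BigAndR BigOrL) auto
  show "\<Pi> \<turnstile> {#?e \<^bold>\<rightarrow> ?a#}" if "p \<notin> mvars \<Pi>" "\<Pi> + \<Gamma> \<turnstile> \<Delta>" for \<Pi>
    using uniformity[OF that(2) refl that(1) _ assms] by (auto intro: BigAndL G4WK.ImpR)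
qed

text \<open>A sequent of weight m < \<open>N\<close> is settled by the hypothesis at m, which yields
  an explicit interpolant from lighter ones. Its existence is all that the choice operator needs, so
  \<open>E\<close> and \<open>A\<close> themselves meet the specification.\<close>

lemma interpolants_below: "interpolants_below p N"
proof (induction N rule: less_induct)
  case (less N)
  show ?case
  proof
    show "is_E p \<Gamma> (E p \<Gamma>)" if "mweight \<Gamma> < N" for \<Gamma>
      using interpolants_below.is_E_BigAnd[OF less[OF that] refl] unfolding E_def by (rule someI)
    show "is_A p \<Gamma> \<Delta> (A p \<Gamma> \<Delta>)" if "size \<Delta> \<le> 1" "mweight \<Gamma> + mweight \<Delta> < N" for \<Gamma> \<Delta>
      using interpolants_below.is_A_Imp[OF less[OF that(2)] refl that(1)] unfolding A_def by (rule someI)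
  qed
qed

theorem theorem5:
  shows "\<exists>(E :: var \<Rightarrow> fm multiset \<Rightarrow> fm) (A :: var \<Rightarrow> fm multiset \<Rightarrow> fm multiset \<Rightarrow> fm).
    \<forall>p \<Gamma> \<Delta>. size \<Delta> \<le> 1 \<longrightarrow>
      vars (E p \<Gamma>) \<subseteq> mvars \<Gamma> - {p} \<and>
      vars (A p \<Gamma> \<Delta>) \<subseteq> (mvars \<Gamma> \<union> mvars \<Delta>) - {p} \<and>
      (\<Gamma> \<turnstile> {#E p \<Gamma>#}) \<and>
      (add_mset (A p \<Gamma> \<Delta>) \<Gamma> \<turnstile> \<Delta>) \<and>
      (\<forall>\<Pi>. p \<notin> mvars \<Pi> \<longrightarrow> (\<Pi> + \<Gamma> \<turnstile> \<Delta>) \<longrightarrow>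
        (p \<notin> mvars \<Delta> \<longrightarrow> (add_mset (E p \<Gamma>) \<Pi> \<turnstile> \<Delta>)) \<and>
        (add_mset (E p \<Gamma>) \<Pi> \<turnstile> {#A p \<Gamma> \<Delta>#}))"
proof (rule exI[of _ E], rule exI[of _ A], intro allI impI)
  fix p \<Gamma> and \<Delta> :: "fm multiset"
  assume "size \<Delta> \<le> 1"
  then have "is_E p \<Gamma> (E p \<Gamma>)" "is_A p \<Gamma> \<Delta> (A p \<Gamma> \<Delta>)"
    using interpolants_below.is_E[OF interpolants_below] interpolants_below.is_A[OF interpolants_below]
      lessI by blast+
  then show "vars (E p \<Gamma>) \<subseteq> mvars \<Gamma> - {p} \<and>
      vars (A p \<Gamma> \<Delta>) \<subseteq> (mvars \<Gamma> \<union> mvars \<Delta>) - {p} \<and>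
      (\<Gamma> \<turnstile> {#E p \<Gamma>#}) \<and>
      (add_mset (A p \<Gamma> \<Delta>) \<Gamma> \<turnstile> \<Delta>) \<and>
      (\<forall>\<Pi>. p \<notin> mvars \<Pi> \<longrightarrow> (\<Pi> + \<Gamma> \<turnstile> \<Delta>) \<longrightarrow>
        (p \<notin> mvars \<Delta> \<longrightarrow> (add_mset (E p \<Gamma>) \<Pi> \<turnstile> \<Delta>)) \<and>
        (add_mset (E p \<Gamma>) \<Pi> \<turnstile> {#A p \<Gamma> \<Delta>#}))"
    \<comment> \<open>Weakening adds \<open>E p \<Gamma>\<close> to the antecedent, since
      \<open>is_A\<close> derives \<open>A p \<Gamma> \<Delta>\<close> from \<open>\<Pi>\<close>
      alone.\<close>
    unfolding is_E_def is_A_def by (auto intro: weakening1)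
qed

end
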